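(* Assume that for each fixed $n\ge1$, $(D_{n,k})_{k\in\mathbb Z}$ is a stationary martingale difference sequence adapted to a stationary nested filtration $(\mathcal F_{n,k})_{k\in\mathbb Z}$, and that the family $(D_{n,1}^2)_{n\ge1}$ is uniformly integrable. Let $(L_j)_{j\ge1}$ be a sequence of real random variables and $c$ a real constant. Assume that for every fixed $m\ge1$, $(D_{n,1},\dots,D_{n,m})$ converges in distribution to $(L_1,\dots,L_m)$ as $n\to\infty$, and that $$\frac1m\sum_{j=1}^{m}L_j^2\to c^2\quad\text{in }L^1\text{ as }m\to\infty .$$ Then $$\frac{1}{\sqrt n}\sum_{k=1}^{n}D_{n,k}\Rightarrow cZ\quad\text{as }n\to\infty ,$$ where $Z$ is a standard normal variable.
   Context: $\Rightarrow$ denotes convergence in distribution. Nested filtration means $\mathcal F_{n,k}\subseteq\mathcal F_{n,k+1}$ for all $k$. Martingale difference sequence means that $D_{n,k}$ is integrable and $\mathcal F_{n,k}$-measurable with $E(D_{n,k}|\mathcal F_{n,k-1})=0$ a.s. for all $k$. *)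

theory Defs
  imports "HOL-Probability.Probability"
begin

definition strictly_stationary :: "'a measure \<Rightarrow> (int \<Rightarrow> 'a \<Rightarrow> real) \<Rightarrow> bool" where
  "strictly_stationary M X \<longleftrightarrow>
     (\<forall>k. X k \<in> borel_measurable M) \<and>
     (\<forall>h. distr M (\<Pi>\<^sub>M k\<in>UNIV. borel) (\<lambda>x k. X (k + h) x)
        = distr M (\<Pi>\<^sub>M k\<in>UNIV. borel) (\<lambda>x k. X k x))"

definition nested_filtration :: "'a measure \<Rightarrow> (int \<Rightarrow> 'a measure) \<Rightarrow> bool" where
  "nested_filtration M F \<longleftrightarrow>
     (\<forall>k. subalgebra M (F k)) \<and> (\<forall>k. sets (F k) \<subseteq> sets (F (k + 1)))"

text \<open>
  A filtration is stationary when a shift of events, modulo null sets, preserves probabilities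
  and the countable Boolean operations and carries the \<open>k\<close>-th \<open>\<sigma>\<close>-algebra onto the next one.
  The shift acts on events, not on points, so that no point transformation of the
  probability space is required: both usual models are instances, namely
  \<open>F (k + 1) = T\<inverse> (F k)\<close> for a measure preserving \<open>T\<close> (\<open>stationary_filtration_transformation\<close>
  below) and the past of a stationary process with values in an arbitrary measurable space
  (\<open>stationary_filtration_process\<close> below).
\<close>

definition stationary_filtration :: "'a measure \<Rightarrow> (int \<Rightarrow> 'a measure) \<Rightarrow> bool" where
  "stationary_filtration M F \<longleftrightarrow>
     (\<exists>\<theta> :: 'a set \<Rightarrow> 'a set. \<forall>k.
        (\<forall>A\<in>sets (F k). \<theta> A \<in> sets M \<and> emeasure M (\<theta> A) = emeasure M A) \<and>
        (\<forall>A\<in>sets (F k). AE x in M. x \<in> \<theta> (space M - A) \<longleftrightarrow> x \<notin> \<theta> A) \<and>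
        (\<forall>A :: nat \<Rightarrow> 'a set. range A \<subseteq> sets (F k) \<longrightarrow>
           (AE x in M. x \<in> \<theta> (\<Union>i. A i) \<longleftrightarrow> (\<exists>i. x \<in> \<theta> (A i)))) \<and>
        (\<forall>A\<in>sets (F k). \<exists>B\<in>sets (F (k + 1)). AE x in M. x \<in> \<theta> A \<longleftrightarrow> x \<in> B) \<and>
        (\<forall>B\<in>sets (F (k + 1)). \<exists>A\<in>sets (F k). AE x in M. x \<in> \<theta> A \<longleftrightarrow> x \<in> B))"

definition martingale_difference ::
  "'a measure \<Rightarrow> (int \<Rightarrow> 'a measure) \<Rightarrow> (int \<Rightarrow> 'a \<Rightarrow> real) \<Rightarrow> bool" where
  "martingale_difference M F D \<longleftrightarrow>
     (\<forall>k. integrable M (D k) \<and> D k \<in> borel_measurable (F k) \<and>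
          (AE x in M. real_cond_exp M (F (k - 1)) (D k) x = 0))"

text \<open>
  The random variables of the family may live on different probability spaces.
\<close>

definition uniformly_integrable ::
  "'i set \<Rightarrow> ('i \<Rightarrow> 'a measure) \<Rightarrow> ('i \<Rightarrow> 'a \<Rightarrow> real) \<Rightarrow> bool" where
  "uniformly_integrable I M X \<longleftrightarrow>
     (\<forall>i\<in>I. X i \<in> borel_measurable (M i)) \<and>
     ((\<lambda>K :: real. SUP i\<in>I. \<integral>\<^sup>+ x. ennreal \<bar>X i x\<bar> * indicator {x. K < \<bar>X i x\<bar>} x \<partial>M i)
        \<longlongrightarrow> 0) at_top"

text \<open>
  Convergence in distribution of the random vectors \<open>(X n j)\<close>, \<open>j \<in> J\<close>, as \<open>n \<rightarrow> \<infinity>\<close>, with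
  the bounded continuous functions on \<open>\<real>\<^sup>J\<close> as test functions. Vectors are functions that
  are \<open>undefined\<close> outside \<open>J\<close>.
\<close>

definition vec_conv_in_distr ::
  "'j set \<Rightarrow> (nat \<Rightarrow> 'a measure) \<Rightarrow> (nat \<Rightarrow> 'j \<Rightarrow> 'a \<Rightarrow> real)
     \<Rightarrow> 'b measure \<Rightarrow> ('j \<Rightarrow> 'b \<Rightarrow> real) \<Rightarrow> bool" where
  "vec_conv_in_distr J M X N Y \<longleftrightarrow>
     (\<forall>f. continuous_map (powertop_real J) euclideanreal f \<and>
          bounded (f ` topspace (powertop_real J)) \<longrightarrow>
        (\<lambda>n. \<integral>x. f (\<lambda>j\<in>J. X n j x) \<partial>M n) \<longlonglongrightarrow> (\<integral>y. f (\<lambda>j\<in>J. Y j y) \<partial>N))"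

definition L1_tendsto_const :: "'b measure \<Rightarrow> (nat \<Rightarrow> 'b \<Rightarrow> real) \<Rightarrow> real \<Rightarrow> bool" where
  "L1_tendsto_const N Y a \<longleftrightarrow>
     (\<forall>m\<ge>1. integrable N (Y m)) \<and> (\<lambda>m. \<integral>y. \<bar>Y m y - a\<bar> \<partial>N) \<longlonglongrightarrow> 0"

lemma stationary_filtration_factor:
  assumes X: "X \<in> measurable M Q" and S: "S \<in> measurable Q Q"
    and inv: "distr (distr M Q X) Q S = distr M Q X"
    and G: "\<And>k. subalgebra Q (G k)"
    and GS: "\<And>k. sets (G (k + 1)) = {S -` C \<inter> space Q | C. C \<in> sets (G k)}"
    and FG: "\<And>k. sets (F k) = {X -` C \<inter> space M | C. C \<in> sets (G k)}"
  shows "stationary_filtration M F"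
proof -
  define ev where "ev A = (SOME C. C \<in> sets Q \<and> X -` C \<inter> space M = A)" for A
  define \<theta> where "\<theta> A = X -` (S -` ev A \<inter> space Q) \<inter> space M" for A
  have GQ: "C \<in> sets Q" if "C \<in> sets (G k)" for C k
    using G[of k] that by (auto simp: subalgebra_def)
  have shift: "emeasure M (X -` (S -` C \<inter> space Q) \<inter> space M) = emeasure M (X -` C \<inter> space M)"
    if "C \<in> sets Q" for C
  proof -
    have "emeasure (distr (distr M Q X) Q S) C = emeasure (distr M Q X) C"
      using inv by simp
    then show ?thesis
      using that X S by (simp add: emeasure_distr measurable_sets)
  qed
  have ev: "ev (X -` C \<inter> space M) \<in> sets Q"
    "X -` ev (X -` C \<inter> space M) \<inter> space M = X -` C \<inter> space M" if "C \<in> sets Q" for C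
    unfolding ev_def by (rule someI2[of _ C]; use that in auto)+
  have rep: "AE x in M. x \<in> \<theta> (X -` C \<inter> space M) \<longleftrightarrow> S (X x) \<in> C" if C: "C \<in> sets Q" for C
  proof -
    let ?E = "ev (X -` C \<inter> space M)"
    let ?N = "(C - ?E) \<union> (?E - C)"
    have N: "?N \<in> sets Q" using C ev(1)[OF C] by auto
    have "X -` ?N \<inter> space M = {}" using ev(2)[OF C] by auto
    then have "emeasure M (X -` (S -` ?N \<inter> space Q) \<inter> space M) = 0"
      using shift[OF N] by simp
    then have "X -` (S -` ?N \<inter> space Q) \<inter> space M \<in> null_sets M"
      using measurable_sets[OF X measurable_sets[OF S N]] by (rule null_setsI)
    then show ?thesis
      by (rule AE_I') (use measurable_space[OF X] in \<open>auto simp: \<theta>_def\<close>)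
  qed
  have 1: "\<theta> A \<in> sets M \<and> emeasure M (\<theta> A) = emeasure M A" if A: "A \<in> sets (F k)" for A k
  proof -
    obtain C where C: "C \<in> sets Q" "A = X -` C \<inter> space M"
      using A GQ by (auto simp: FG)
    have E: "ev A \<in> sets Q" using ev(1)[OF C(1)] C(2) by simp
    have "emeasure M (\<theta> A) = emeasure M (X -` ev A \<inter> space M)"
      unfolding \<theta>_def by (rule shift[OF E])
    moreover have "\<theta> A \<in> sets M"
      unfolding \<theta>_def using E X S by (auto intro!: measurable_sets)
    ultimately show ?thesis using ev(2)[OF C(1)] C(2) by simp
  qed
  have 2: "AE x in M. x \<in> \<theta> (space M - A) \<longleftrightarrow> x \<notin> \<theta> A" if A: "A \<in> sets (F k)" for A k
  proof -
    obtain C where C: "C \<in> sets Q" "A = X -` C \<inter> space M"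
      using A GQ by (auto simp: FG)
    have c: "space M - A = X -` (space Q - C) \<inter> space M"
      using C X by (auto simp: measurable_space)
    have sp: "AE x in M. S (X x) \<in> space Q"
      using X S by (auto intro!: AE_I2 simp: measurable_space)
    have "space Q - C \<in> sets Q" using C by auto
    then have "AE x in M. x \<in> \<theta> (space M - A) \<longleftrightarrow> S (X x) \<in> space Q - C"
      unfolding c by (rule rep)
    moreover have "AE x in M. x \<in> \<theta> A \<longleftrightarrow> S (X x) \<in> C"
      unfolding C(2) by (rule rep[OF C(1)])
    ultimately show ?thesis
      using sp by eventually_elim blast
  qed
  have 3: "AE x in M. x \<in> \<theta> (\<Union>i. A i) \<longleftrightarrow> (\<exists>i. x \<in> \<theta> (A i))"
    if A: "range A \<subseteq> sets (F k)" for A :: "nat \<Rightarrow> 'a set" and k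
  proof -
    have "\<forall>i. \<exists>C. C \<in> sets Q \<and> A i = X -` C \<inter> space M"
    proof
      fix i
      have "A i \<in> sets (F k)" using A by auto
      then show "\<exists>C. C \<in> sets Q \<and> A i = X -` C \<inter> space M"
        using GQ by (auto simp: FG)
    qed
    then obtain C where C: "\<And>i. C i \<in> sets Q" "\<And>i. A i = X -` C i \<inter> space M"
      by metis
    have c: "(\<Union>i. A i) = X -` (\<Union>i. C i) \<inter> space M"
      using C by auto
    have "AE x in M. \<forall>i. x \<in> \<theta> (A i) \<longleftrightarrow> S (X x) \<in> C i"
      unfolding AE_all_countable C(2) using rep C(1) by blast
    moreover have "AE x in M. x \<in> \<theta> (\<Union>i. A i) \<longleftrightarrow> S (X x) \<in> (\<Union>i. C i)"
      unfolding c using C(1) by (intro rep) auto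
    ultimately show ?thesis by eventually_elim auto
  qed
  have step: "AE x in M. x \<in> \<theta> (X -` C \<inter> space M) \<longleftrightarrow> x \<in> X -` (S -` C \<inter> space Q) \<inter> space M"
    if "C \<in> sets Q" for C
    using rep[OF that] AE_space by eventually_elim (use X in \<open>auto simp: measurable_space\<close>)
  have 4: "\<exists>B\<in>sets (F (k + 1)). AE x in M. x \<in> \<theta> A \<longleftrightarrow> x \<in> B" if A: "A \<in> sets (F k)" for A k
  proof -
    obtain C where C: "C \<in> sets (G k)" "A = X -` C \<inter> space M"
      using A by (auto simp: FG)
    have "S -` C \<inter> space Q \<in> sets (G (k + 1))"
      unfolding GS using C(1) by blast
    then have "X -` (S -` C \<inter> space Q) \<inter> space M \<in> sets (F (k + 1))"
      unfolding FG by blast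
    with step[OF GQ[OF C(1)]] show ?thesis
      unfolding C(2) by (rule bexI)
  qed
  have 5: "\<exists>A\<in>sets (F k). AE x in M. x \<in> \<theta> A \<longleftrightarrow> x \<in> B" if B: "B \<in> sets (F (k + 1))" for B k
  proof -
    obtain C' where C': "C' \<in> sets (G (k + 1))" "B = X -` C' \<inter> space M"
      using B unfolding FG by blast
    then obtain C where C: "C \<in> sets (G k)" "C' = S -` C \<inter> space Q"
      unfolding GS by blast
    have "X -` C \<inter> space M \<in> sets (F k)"
      unfolding FG using C(1) by blast
    with step[OF GQ[OF C(1)]] show ?thesis
      unfolding C'(2) C(2) by (rule bexI)
  qed
  show ?thesis
    unfolding stationary_filtration_def
    by (intro exI[of _ \<theta>] allI conjI ballI impI)
      (erule 1[THEN conjunct1] 1[THEN conjunct2] 2 3 4 5)+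
qed

lemma stationary_filtration_transformation:
  assumes "nested_filtration M F"
    and "T \<in> measurable M M" "distr M M T = M"
    and "\<And>k. sets (F (k + 1)) = {T -` A \<inter> space M | A. A \<in> sets (F k)}"
  shows "stationary_filtration M F"
proof (rule stationary_filtration_factor[of id M M T F])
  fix k
  have "A \<subseteq> space M" if "A \<in> sets (F k)" for A
    using assms(1) that sets.sets_into_space[of A "F k"]
    by (auto simp: nested_filtration_def subalgebra_def)
  then show "sets (F k) = {id -` C \<inter> space M | C. C \<in> sets (F k)}"
    by (auto simp: Int_absorb2)
qed (use assms in \<open>auto simp: nested_filtration_def distr_id id_def\<close>)

lemma stationary_filtration_process:
  fixes \<xi> :: "int \<Rightarrow> 'a \<Rightarrow> 's" and E :: "'s measure"
  assumes \<xi>: "\<And>k. \<xi> k \<in> measurable M E"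
    and stat: "distr M (\<Pi>\<^sub>M k\<in>UNIV. E) (\<lambda>x k. \<xi> (k + 1) x)
             = distr M (\<Pi>\<^sub>M k\<in>UNIV. E) (\<lambda>x k. \<xi> k x)"
    and F: "\<And>k. F k = sigma (space M) {\<xi> j -` A \<inter> space M | j A. j \<le> k \<and> A \<in> sets E}"
  shows "stationary_filtration M F"
proof -
  let ?Q = "\<Pi>\<^sub>M k\<in>(UNIV :: int set). E"
  let ?X = "\<lambda>x k. \<xi> k x"
  let ?S = "\<lambda>w (k :: int). w (k + 1)"
  let ?g = "\<lambda>k. {(\<lambda>w. w j) -` A \<inter> space ?Q | j A. j \<le> k \<and> A \<in> sets E}"
  let ?G = "\<lambda>k. sigma (space ?Q) (?g k)"
  have X: "?X \<in> measurable M ?Q"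
    by (rule measurable_PiM_single')
      (use \<xi> in \<open>auto simp: space_PiM PiE_iff intro: measurable_space[OF \<xi>]\<close>)
  have S: "?S \<in> measurable ?Q ?Q"
    by (rule measurable_PiM_single') (auto simp: space_PiM PiE_iff)
  have gQ: "?g k \<subseteq> sets ?Q" for k
    by (auto intro!: measurable_sets measurable_component_singleton)
  have setsG: "sets (?G k) = sigma_sets (space ?Q) (?g k)" for k
    using gQ[of k] sets.space_closed[of ?Q] by (intro sets_measure_of) blast
  have setsF: "sets (F k) = sigma_sets (space M) {\<xi> j -` A \<inter> space M | j A. j \<le> k \<and> A \<in> sets E}"
    for k unfolding F by (intro sets_measure_of) auto
  show ?thesis
  proof (rule stationary_filtration_factor[OF X S, of ?G])
    show "distr (distr M ?Q ?X) ?Q ?S = distr M ?Q ?X"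
      using stat by (simp add: distr_distr[OF S X] comp_def)
    show "subalgebra ?Q (?G k)" for k
      using gQ[of k] unfolding subalgebra_def setsG
      by (auto simp: space_measure_of_conv intro: subsetD[OF sets.sigma_sets_subset])
    show "sets (?G (k + 1)) = {?S -` C \<inter> space ?Q | C. C \<in> sets (?G k)}" for k
    proof -
      have "{?S -` C \<inter> space ?Q | C. C \<in> ?g k} = ?g (k + 1)"
      proof safe
        fix j A assume "j \<le> k" "A \<in> sets E"
        then show "\<exists>j' A'. ?S -` ((\<lambda>w. w j) -` A \<inter> space ?Q) \<inter> space ?Q
            = (\<lambda>w. w j') -` A' \<inter> space ?Q \<and> j' \<le> k + 1 \<and> A' \<in> sets E"
          by (intro exI[of _ "j + 1"] exI[of _ A]) (auto simp: space_PiM PiE_iff)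
      next
        fix j A assume "j \<le> k + 1" "A \<in> sets E"
        then show "\<exists>C. (\<lambda>w. w j) -` A \<inter> space ?Q = ?S -` C \<inter> space ?Q \<and> C \<in> ?g k"
          by (intro exI[of _ "(\<lambda>w. w (j - 1)) -` A \<inter> space ?Q"] conjI CollectI
              exI[of _ "j - 1"] exI[of _ A]) (auto simp: space_PiM PiE_iff)
      qed
      then show ?thesis
        using sigma_sets_vimage_commute[of ?S "space ?Q" "space ?Q" "?g k"] S
        unfolding setsG by (simp add: measurable_def)
    qed
    show "sets (F k) = {?X -` C \<inter> space M | C. C \<in> sets (?G k)}" for k
    proof -
      have "{?X -` C \<inter> space M | C. C \<in> ?g k} = {\<xi> j -` A \<inter> space M | j A. j \<le> k \<and> A \<in> sets E}"
      proof safe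
        fix j A assume "j \<le> k" "A \<in> sets E"
        then show "\<exists>j' A'. ?X -` ((\<lambda>w. w j) -` A \<inter> space ?Q) \<inter> space M
            = \<xi> j' -` A' \<inter> space M \<and> j' \<le> k \<and> A' \<in> sets E"
          using X by (intro exI[of _ j] exI[of _ A]) (auto simp: measurable_def)
      next
        fix j A assume "j \<le> k" "A \<in> sets E"
        then show "\<exists>C. \<xi> j -` A \<inter> space M = ?X -` C \<inter> space M \<and> C \<in> ?g k"
          using X by (intro exI[of _ "(\<lambda>w. w j) -` A \<inter> space ?Q"]) (auto simp: measurable_def)
      qed
      then show ?thesis
        using sigma_sets_vimage_commute[of ?X "space M" "space ?Q" "?g k"] X
        unfolding setsG setsF by (simp add: measurable_def)
    qed
  qed
qed

end

theory Submission
  imports Defs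
begin

text \<open>
  The idea is that an array of martingale differences \<open>X k = D n k / sqrt n\<close> has Gaussian row sums
  in the limit as soon as the sum of squares \<open>V = (\<Sum>k. (X k)\<^sup>2)\<close> tends to \<open>c\<^sup>2\<close> in
  \<open>L\<^sup>1\<close> and a Lindeberg condition holds. Stationarity of \<open>D n\<close> reduces the first to a
  block of fixed length and the second to the single variable \<open>D n 1\<close>.

  For the characteristic function of the row sum \<open>S\<close>, take the product of the factors
  \<open>exp (\<i> t x + t\<^sup>2 min (x\<^sup>2) 1 / 2)\<close> with \<open>x = X k\<close>. Such a factor
  is \<open>1 + \<i> t x\<close> up to a constant times \<open>x\<^sup>2 min 1 \<bar>x\<bar>\<close>. The linear term
  has conditional mean zero, so that the mean of the product is \<open>1\<close> up to the total weight
  \<open>\<Sum>k. E ((X k)\<^sup>2 min 1 \<bar>X k\<bar>)\<close>. To keep the product bounded it is stopped once its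
  modulus is too large (\<open>expectation_stopped_prod\<close>). Where it has not been stopped it is
  \<open>exp (\<i> t S + t\<^sup>2 V / 2)\<close> up to the truncation of the squares, and since \<open>V\<close> is close
  to \<open>c\<^sup>2\<close> it is about \<open>exp (\<i> t S) exp (t\<^sup>2 c\<^sup>2 / 2)\<close>. Hence
  \<open>E exp (\<i> t S)\<close> differs from \<open>exp (- t\<^sup>2 c\<^sup>2 / 2)\<close> by at most a constant times
  \<open>E \<bar>V - c\<^sup>2\<bar>\<close> plus the total weight (\<open>martingale_difference_char_bound\<close>).

  By stationarity the total weight is \<open>E (D\<^sup>2 min 1 (\<bar>D\<bar> / sqrt n))\<close> with
  \<open>D = D n 1\<close>, and it tends to zero by uniform integrability.

  For \<open>E \<bar>V - c\<^sup>2\<bar>\<close>, cut \<open>{1..n}\<close> into blocks of a fixed length \<open>m\<close>. All blocks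
  have the same law, so up to an error of order \<open>m / n\<close> this mean is at most that of
  \<open>\<bar>(1 / m) (\<Sum>j\<le>m. (D n j)\<^sup>2) - c\<^sup>2\<bar>\<close>
  (\<open>stationary_average_le_block_average\<close>). As \<open>n\<close> grows, convergence in distribution and
  uniform integrability bound the latter by the corresponding mean for \<open>L\<close>
  (\<open>second_moment_block_limit\<close>), which is small for large \<open>m\<close>.
  Levy's continuity theorem concludes.
\<close>

section \<open>A martingale bound for characteristic functions\<close>

text \<open>
  This is \<open>min (x\<^sup>2) (\<bar>x\<bar> ^ 3)\<close>: cubic near zero, which makes it negligible against
  the variance for small increments, and dominated by the square, so that two moments suffice.
\<close>

definition cubic_weight :: "real \<Rightarrow> real" where
  "cubic_weight x = x\<^sup>2 * min 1 \<bar>x\<bar>"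

text \<open>
  The real exponent compensates the decay of the characteristic function of one increment. Truncating
  the square there, and not the increment, bounds the factor without disturbing the martingale
  property.
\<close>

definition balanced_exp :: "real \<Rightarrow> real \<Rightarrow> complex" where
  "balanced_exp t x = exp (\<i> * complex_of_real (t * x) + complex_of_real (t\<^sup>2 / 2 * min (x\<^sup>2) 1))"

lemma cubic_weight_nonneg: "0 \<le> cubic_weight x"
  by (simp add: cubic_weight_def)

lemma cubic_weight_le_square: "cubic_weight x \<le> x\<^sup>2"
  using mult_left_mono[of "min 1 \<bar>x\<bar>" 1 "x\<^sup>2"] by (simp add: cubic_weight_def)

lemma cubic_weight_measurable [measurable]: "cubic_weight \<in> borel_measurable borel"
  unfolding cubic_weight_def[abs_def] by measurable

lemma balanced_exp_measurable [measurable]: "balanced_exp t \<in> borel_measurable borel"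
  unfolding balanced_exp_def[abs_def] by measurable

lemma norm_balanced_exp: "cmod (balanced_exp t x) = exp (t\<^sup>2 / 2 * min (x\<^sup>2) 1)"
  by (simp add: balanced_exp_def)

lemma norm_balanced_exp_le: "cmod (balanced_exp t x) \<le> exp (t\<^sup>2 / 2)"
  unfolding norm_balanced_exp by (simp add: mult_left_le)

text \<open>
  Near zero the quadratic term \<open>- t\<^sup>2 x\<^sup>2 / 2\<close> of \<open>exp (\<i> t x)\<close> is cancelled
  by the real exponent, which leaves a remainder of third order. Away from zero everything on the
  left grows at most linearly.
\<close>

lemma balanced_exp_expansion:
  "\<exists>C\<ge>0. \<forall>x. cmod (balanced_exp t x - 1 - \<i> * complex_of_real (t * x)) \<le> C * cubic_weight x"
proof -
  define B where "B = \<bar>t\<bar> + t\<^sup>2 / 2"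
  define C1 where "C1 = exp (t\<^sup>2 / 2) * B ^ 3 / 2 + (\<bar>t\<bar> ^ 3 / 2 + t ^ 4 / 8)"
  define C2 where "C2 = exp (t\<^sup>2 / 2) + 1 + \<bar>t\<bar>"
  have C1: "C1 \<ge> 0" and C2: "C2 \<ge> 0" by (simp_all add: C1_def C2_def B_def)
  have "cmod (balanced_exp t x - 1 - \<i> * complex_of_real (t * x)) \<le> (C1 + C2) * cubic_weight x" for x
  proof (cases "\<bar>x\<bar> \<le> 1")
    case True
    then have x2: "x\<^sup>2 \<le> 1" by (simp add: abs_square_le_1)
    define z where "z = \<i> * complex_of_real (t * x) + complex_of_real (t\<^sup>2 / 2 * x\<^sup>2)"
    have g: "balanced_exp t x = exp z" using x2 by (simp add: balanced_exp_def z_def)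
    have w: "cubic_weight x = \<bar>x\<bar> ^ 3"
      using True by (simp add: cubic_weight_def power3_eq_cube power2_eq_square)
    have "cmod z \<le> \<bar>t * x\<bar> + t\<^sup>2 / 2 * x\<^sup>2"
      unfolding z_def
      by (rule order_trans[OF norm_triangle_ineq]) (simp add: norm_mult norm_power norm_divide)
    also have "\<dots> \<le> \<bar>t\<bar> * \<bar>x\<bar> + t\<^sup>2 / 2 * \<bar>x\<bar>"
    proof -
      have "x\<^sup>2 \<le> \<bar>x\<bar>" using True mult_left_le[of "\<bar>x\<bar>" "\<bar>x\<bar>"]
        by (simp add: power2_eq_square flip: abs_mult)
      then show ?thesis by (intro add_mono mult_left_mono) (auto simp: abs_mult)
    qed
    finally have nz: "cmod z \<le> B * \<bar>x\<bar>" by (simp add: B_def algebra_simps)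
    have re: "\<bar>Re z\<bar> \<le> t\<^sup>2 / 2" using x2 by (simp add: z_def mult_left_le)
    have "cmod (exp z - (1 + z + z\<^sup>2 / 2)) \<le> exp \<bar>Re z\<bar> * cmod z ^ 3 / 2"
      using Taylor_exp[of z 2] by (simp add: numeral_2_eq_2 eval_nat_numeral)
    also have "\<dots> \<le> exp (t\<^sup>2 / 2) * (B * \<bar>x\<bar>) ^ 3 / 2"
      using re nz by (intro divide_right_mono mult_mono power_mono) auto
    finally have 1: "cmod (exp z - (1 + z + z\<^sup>2 / 2)) \<le> exp (t\<^sup>2 / 2) * B ^ 3 / 2 * \<bar>x\<bar> ^ 3"
      by (simp add: power_mult_distrib)
    \<comment> \<open>The quadratic terms cancel: this is what the factor with the square is there for.\<close>
    have "1 + z + z\<^sup>2 / 2 - 1 - \<i> * complex_of_real (t * x)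
        = \<i> * complex_of_real (t ^ 3 * x ^ 3 / 2) + complex_of_real (t ^ 4 * x ^ 4 / 8)"
      by (simp add: z_def power2_eq_square power3_eq_cube power4_eq_xxxx field_simps)
    then have "cmod (1 + z + z\<^sup>2 / 2 - 1 - \<i> * complex_of_real (t * x))
        \<le> \<bar>t ^ 3 * x ^ 3 / 2\<bar> + \<bar>t ^ 4 * x ^ 4 / 8\<bar>"
      by (metis norm_triangle_ineq norm_mult norm_ii mult_1 norm_of_real)
    also have "\<dots> \<le> (\<bar>t\<bar> ^ 3 / 2 + t ^ 4 / 8) * \<bar>x\<bar> ^ 3"
    proof -
      have "x ^ 4 \<le> \<bar>x\<bar> ^ 3"
        using True power_decreasing[of 3 4 "\<bar>x\<bar>"] by (simp add: power_even_abs)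
      then have "t ^ 4 * x ^ 4 \<le> t ^ 4 * \<bar>x\<bar> ^ 3" by (intro mult_left_mono) auto
      then show ?thesis by (simp add: abs_mult power_abs algebra_simps)
    qed
    finally have 2: "cmod (1 + z + z\<^sup>2 / 2 - 1 - \<i> * complex_of_real (t * x))
        \<le> (\<bar>t\<bar> ^ 3 / 2 + t ^ 4 / 8) * \<bar>x\<bar> ^ 3" .
    have "cmod (exp z - 1 - \<i> * complex_of_real (t * x)) \<le> C1 * \<bar>x\<bar> ^ 3"
      using 1 2 norm_triangle_ineq[of "exp z - (1 + z + z\<^sup>2 / 2)"
          "1 + z + z\<^sup>2 / 2 - 1 - \<i> * complex_of_real (t * x)"]
      by (simp add: C1_def algebra_simps)
    also have "\<dots> \<le> (C1 + C2) * \<bar>x\<bar> ^ 3" using C2 by (intro mult_right_mono) auto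
    finally show ?thesis by (simp add: g w)
  next
    case False
    then have x: "1 \<le> \<bar>x\<bar>" by simp
    have w: "cubic_weight x = x\<^sup>2" using x by (simp add: cubic_weight_def)
    have x2: "1 \<le> x\<^sup>2" using x by (metis one_le_power power2_abs)
    have xx: "\<bar>x\<bar> \<le> x\<^sup>2" using x mult_left_mono[of 1 "\<bar>x\<bar>" "\<bar>x\<bar>"] by (simp add: power2_eq_square flip: abs_mult)
    have "cmod (balanced_exp t x - 1 - \<i> * complex_of_real (t * x)) \<le> exp (t\<^sup>2 / 2) + 1 + \<bar>t\<bar> * \<bar>x\<bar>"
      using norm_balanced_exp_le[of t x]
        norm_triangle_ineq4[of "balanced_exp t x - 1" "\<i> * complex_of_real (t * x)"]
        norm_triangle_ineq4[of "balanced_exp t x" 1]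
      by (simp add: norm_mult)
    also have "\<dots> \<le> exp (t\<^sup>2 / 2) * x\<^sup>2 + 1 * x\<^sup>2 + \<bar>t\<bar> * x\<^sup>2"
      using x2 xx by (intro add_mono mult_left_mono) auto
    also have "\<dots> \<le> (C1 + C2) * x\<^sup>2" using C1 by (simp add: C2_def algebra_simps)
    finally show ?thesis by (simp add: w)
  qed
  then show ?thesis using C1 C2 by (intro exI[of _ "C1 + C2"]) auto
qed

text \<open>
  The factor \<open>k\<close> is used only if the product up to then is at most \<open>exp (t\<^sup>2 K / 2)\<close>
  in modulus. That modulus depends on the past alone, so the stopping decision is predictable.
\<close>

primrec stopped_prod :: "real \<Rightarrow> real \<Rightarrow> (nat \<Rightarrow> real) \<Rightarrow> nat \<Rightarrow> complex" where
  "stopped_prod t K x 0 = 1"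
| "stopped_prod t K x (Suc k) = (if cmod (stopped_prod t K x k) \<le> exp (t\<^sup>2 / 2 * K)
     then stopped_prod t K x k * balanced_exp t (x k) else stopped_prod t K x k)"

lemma norm_stopped_prod_le:
  assumes "0 \<le> K"
  shows "cmod (stopped_prod t K x k) \<le> exp (t\<^sup>2 / 2 * (K + 1))"
proof (induction k)
  case (Suc k)
  have "cmod (stopped_prod t K x k * balanced_exp t (x k)) \<le> exp (t\<^sup>2 / 2 * K) * exp (t\<^sup>2 / 2)"
    if "cmod (stopped_prod t K x k) \<le> exp (t\<^sup>2 / 2 * K)"
    using that norm_balanced_exp_le[of t "x k"] unfolding norm_mult by (intro mult_mono) auto
  moreover have "exp (t\<^sup>2 / 2 * K) * exp (t\<^sup>2 / 2) = exp (t\<^sup>2 / 2 * (K + 1))"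
    by (simp add: algebra_simps flip: exp_add)
  ultimately show ?case using Suc by simp
qed (use assms in auto)

text \<open>
  The modulus of the product before stopping is the exponential of \<open>t\<^sup>2 / 2\<close> times the sum
  of truncated squares. A sum of at most \<open>K\<close> therefore never triggers the stopping.
\<close>

lemma stopped_prod_eq:
  assumes "(\<Sum>k<n. min ((x k)\<^sup>2) 1) \<le> K"
  shows "stopped_prod t K x n
    = exp (\<i> * complex_of_real (t * (\<Sum>k<n. x k))
        + complex_of_real (t\<^sup>2 / 2 * (\<Sum>k<n. min ((x k)\<^sup>2) 1)))"
  using assms
proof (induction n)
  case (Suc n)
  have le: "(\<Sum>k<n. min ((x k)\<^sup>2) 1) \<le> K" by (rule order_trans[OF _ Suc.prems]) simp
  have "cmod (stopped_prod t K x n) \<le> exp (t\<^sup>2 / 2 * K)"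
    unfolding Suc.IH[OF le] using le by (simp add: mult_left_mono)
  then have "stopped_prod t K x (Suc n) = stopped_prod t K x n * balanced_exp t (x n)" by simp
  then show ?case
    unfolding Suc.IH[OF le]
    by (simp add: balanced_exp_def distrib_left add_ac del: stopped_prod.simps flip: exp_add)
qed simp

lemma abs_exp_minus_one_le:
  assumes "u \<le> b" "0 \<le> (b::real)"
  shows "\<bar>1 - exp u\<bar> \<le> exp b * \<bar>u\<bar>"
proof (cases "0 \<le> u")
  case True
  have "exp u * (1 - u) \<le> exp u * exp (- u)"
    using exp_ge_add_one_self[of "- u"] by (intro mult_left_mono) auto
  then have "exp u - 1 \<le> exp u * u" by (simp add: algebra_simps flip: exp_add)
  also have "\<dots> \<le> exp b * u" using True assms by (intro mult_right_mono) auto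
  finally show ?thesis using True by simp
next
  case False
  have "1 - exp u \<le> 1 * \<bar>u\<bar>" using False exp_ge_add_one_self[of u] by linarith
  also have "\<dots> \<le> exp b * \<bar>u\<bar>" using assms by (intro mult_right_mono) auto
  finally show ?thesis using False by simp
qed

text \<open>
  If the sum \<open>Q\<close> of truncated squares is at most \<open>c\<^sup>2 + 1\<close>, nothing has been stopped and
  the two sides differ by the factor \<open>exp (t\<^sup>2 (Q - c\<^sup>2) / 2)\<close>. Otherwise the difference
  is merely bounded, but then \<open>\<bar>Q - c\<^sup>2\<bar>\<close> is at least one. Truncating a square costs
  at most its cubic weight.
\<close>

lemma stopped_prod_approximates:
  fixes c :: real
  shows "cmod (iexp (t * (\<Sum>k<n. x k)) - exp (- (t\<^sup>2 * c\<^sup>2) / 2) * stopped_prod t (c\<^sup>2 + 1) x n)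
    \<le> (t\<^sup>2 / 2 * exp (t\<^sup>2 / 2) + 1 + exp (t\<^sup>2))
      * (\<bar>(\<Sum>k<n. (x k)\<^sup>2) - c\<^sup>2\<bar> + (\<Sum>k<n. cubic_weight (x k)))"
    (is "?lhs \<le> ?A * ?E")
proof -
  define Q where "Q = (\<Sum>k<n. min ((x k)\<^sup>2) 1)"
  have "(\<Sum>k<n. (x k)\<^sup>2) - Q \<le> (\<Sum>k<n. cubic_weight (x k))"
    unfolding Q_def sum_subtractf[symmetric]
  proof (rule sum_mono)
    fix k show "(x k)\<^sup>2 - min ((x k)\<^sup>2) 1 \<le> cubic_weight (x k)"
    proof (cases "\<bar>x k\<bar> \<le> 1")
      case True
      then show ?thesis using cubic_weight_nonneg[of "x k"] by (simp add: abs_square_le_1 min_def)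
    next
      case False
      then show ?thesis by (simp add: cubic_weight_def min_def)
    qed
  qed
  moreover have "Q \<le> (\<Sum>k<n. (x k)\<^sup>2)" unfolding Q_def by (intro sum_mono) auto
  ultimately have QE: "\<bar>Q - c\<^sup>2\<bar> \<le> ?E" by linarith
  have "?lhs \<le> ?A * \<bar>Q - c\<^sup>2\<bar>"
  proof (cases "Q \<le> c\<^sup>2 + 1")
    case True
    let ?u = "t\<^sup>2 / 2 * (Q - c\<^sup>2)"
    have "exp (- (t\<^sup>2 * c\<^sup>2) / 2) * stopped_prod t (c\<^sup>2 + 1) x n = iexp (t * (\<Sum>k<n. x k)) * exp ?u"
      using stopped_prod_eq[of x n "c\<^sup>2 + 1" t] True unfolding Q_def[symmetric]
      by (simp add: exp_of_real[symmetric] algebra_simps diff_divide_distrib flip: exp_add)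
    then have "?lhs = cmod (iexp (t * (\<Sum>k<n. x k)) * (1 - complex_of_real (exp ?u)))"
      by (simp add: algebra_simps)
    also have "\<dots> = \<bar>1 - exp ?u\<bar>"
      unfolding norm_mult norm_exp_i_times by (metis mult_1 norm_of_real of_real_1 of_real_diff)
    also have "\<dots> \<le> exp (t\<^sup>2 / 2) * \<bar>?u\<bar>"
      using True by (intro abs_exp_minus_one_le) (auto intro: mult_left_le)
    also have "\<dots> = (t\<^sup>2 / 2 * exp (t\<^sup>2 / 2)) * \<bar>Q - c\<^sup>2\<bar>" by (simp add: abs_mult)
    also have "\<dots> \<le> ?A * \<bar>Q - c\<^sup>2\<bar>" by (intro mult_right_mono) auto
    finally show ?thesis .
  next
    case False
    have "?lhs \<le> 1 + exp (- (t\<^sup>2 * c\<^sup>2) / 2) * cmod (stopped_prod t (c\<^sup>2 + 1) x n)"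
      by (rule order_trans[OF norm_triangle_ineq4]) (simp add: norm_mult)
    also have "\<dots> \<le> 1 + exp (- (t\<^sup>2 * c\<^sup>2) / 2) * exp (t\<^sup>2 / 2 * (c\<^sup>2 + 1 + 1))"
      by (intro add_left_mono mult_left_mono norm_stopped_prod_le) auto
    also have "\<dots> = 1 + exp (t\<^sup>2)" by (simp add: algebra_simps add_divide_distrib flip: exp_add)
    also have "\<dots> \<le> ?A * 1" by simp
    also have "\<dots> \<le> ?A * \<bar>Q - c\<^sup>2\<bar>" using False by (intro mult_left_mono) auto
    finally show ?thesis .
  qed
  also have "\<dots> \<le> ?A * ?E" using QE by (intro mult_left_mono) auto
  finally show ?thesis .
qed

text \<open>
  One more factor changes the product by its current value, which is bounded and measurable for the
  past, times \<open>\<i> t X\<close> plus a remainder. The first part has mean zero by the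
  martingale property, and the remainder is of the size of the cubic weight.
\<close>

lemma (in prob_space) expectation_stopped_prod:
  fixes X :: "nat \<Rightarrow> 'a \<Rightarrow> real" and G :: "nat \<Rightarrow> 'a measure"
  assumes sub: "\<And>k. subalgebra M (G k)" and nested: "\<And>k. sets (G k) \<subseteq> sets (G (Suc k))"
    and adapted: "\<And>k. X k \<in> borel_measurable (G (Suc k))"
    and sq: "\<And>k. integrable M (\<lambda>x. (X k x)\<^sup>2)"
    and mds: "\<And>k. AE x in M. real_cond_exp M (G k) (X k) x = 0"
    and C: "\<And>y. cmod (balanced_exp t y - 1 - \<i> * complex_of_real (t * y)) \<le> C * cubic_weight y"
    and K: "0 \<le> K"
  shows "cmod (expectation (\<lambda>x. stopped_prod t K (\<lambda>k. X k x) n) - 1)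
    \<le> C * exp (t\<^sup>2 / 2 * (K + 1)) * (\<Sum>k<n. expectation (\<lambda>x. cubic_weight (X k x)))"
proof (induction n)
  case 0
  show ?case by (simp add: prob_space)
next
  case (Suc n)
  define P where "P k x = stopped_prod t K (\<lambda>k. X k x) k" for k x
  have spG: "space (G k) = space M" for k using sub[of k] by (simp add: subalgebra_def)
  have subG: "subalgebra (G (Suc k)) (G k)" for k
    using nested[of k] by (simp add: subalgebra_def spG)
  have PG: "P k \<in> borel_measurable (G k)" for k
  proof (induction k)
    case 0
    then show ?case by (simp add: P_def)
  next
    case (Suc k)
    have [measurable]: "P k \<in> borel_measurable (G (Suc k))"
      using measurable_from_subalg[OF subG Suc.IH] .
    note adapted[of k, measurable]
    have "P (Suc k) = (\<lambda>x. if cmod (P k x) \<le> exp (t\<^sup>2 / 2 * K) then P k x * balanced_exp t (X k x) else P k x)"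
      by (auto simp: P_def fun_eq_iff)
    then show ?case by simp
  qed
  note PM [measurable] = measurable_from_subalg[OF sub PG]
  have XM [measurable]: "X k \<in> borel_measurable M" for k
    using measurable_from_subalg[OF sub adapted] .
  have Pb: "cmod (P k x) \<le> exp (t\<^sup>2 / 2 * (K + 1))" for k x
    unfolding P_def using norm_stopped_prod_le[OF K] .
  have Pint: "integrable M (P k)" for k
    by (rule integrable_const_bound[OF AE_I2[OF Pb] PM])
  have Xint: "integrable M (X k)" for k
    using square_integrable_imp_integrable[OF XM sq] .
  have Wint: "integrable M (\<lambda>x. cubic_weight (X k x))" for k
    by (rule Bochner_Integration.integrable_bound[OF sq[of k]])
      (auto simp: cubic_weight_nonneg cubic_weight_le_square)
  \<comment> \<open>The predictable multiplier of the next factor: it vanishes once the product is stopped.\<close>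
  define H where "H x = (if cmod (P n x) \<le> exp (t\<^sup>2 / 2 * K) then P n x else 0)" for x
  have HG: "H \<in> borel_measurable (G n)"
    unfolding H_def using PG[of n] by measurable
  note HM [measurable] = measurable_from_subalg[OF sub HG]
  have Hb: "cmod (H x) \<le> exp (t\<^sup>2 / 2 * (K + 1))" for x
    using Pb[of n x] by (simp add: H_def)
  have zero: "expectation (\<lambda>x. f x * X n x) = 0" and fint: "integrable M (\<lambda>x. f x * X n x)"
    if f: "f \<in> borel_measurable (G n)" and fb: "\<And>x. \<bar>f x\<bar> \<le> exp (t\<^sup>2 / 2 * (K + 1))" for f
  proof -
    interpret S: finite_measure_subalgebra M "G n" by unfold_locales (rule sub)
    have [measurable]: "f \<in> borel_measurable M" using measurable_from_subalg[OF sub f] .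
    show fi: "integrable M (\<lambda>x. f x * X n x)"
      by (rule Bochner_Integration.integrable_bound[OF integrable_mult_right[OF Xint[of n], of "exp (t\<^sup>2 / 2 * (K + 1))"]])
        (auto simp: abs_mult intro!: AE_I2 mult_right_mono fb[simplified])
    have "expectation (\<lambda>x. f x * X n x) = expectation (\<lambda>x. f x * real_cond_exp M (G n) (X n) x)"
      using S.real_cond_exp_intg(2)[OF fi f XM] by simp
    also have "\<dots> = expectation (\<lambda>x. 0)"
      using measurable_from_subalg[OF sub f] mds[of n] by (intro integral_cong_AE) auto
    finally show "expectation (\<lambda>x. f x * X n x) = 0" by simp
  qed
  have Re: "(\<lambda>x. Re (H x)) \<in> borel_measurable (G n)" and Im: "(\<lambda>x. Im (H x)) \<in> borel_measurable (G n)"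
    using HG by measurable
  have Reb: "\<bar>Re (H x)\<bar> \<le> exp (t\<^sup>2 / 2 * (K + 1))" and Imb: "\<bar>Im (H x)\<bar> \<le> exp (t\<^sup>2 / 2 * (K + 1))" for x
    using Hb[of x] abs_Re_le_cmod[of "H x"] abs_Im_le_cmod[of "H x"] by linarith+
  have HX: "has_bochner_integral M (\<lambda>x. H x * complex_of_real (X n x)) 0"
  proof -
    have i: "integrable M (\<lambda>x. H x * complex_of_real (X n x))"
      by (rule Bochner_Integration.integrable_bound[OF integrable_mult_right[OF Xint[of n], of "exp (t\<^sup>2 / 2 * (K + 1))"]])
        (auto simp: norm_mult abs_mult intro!: AE_I2 mult_right_mono Hb[simplified])
    have "expectation (\<lambda>x. H x * complex_of_real (X n x)) = 0"
      using zero[OF Re Reb] zero[OF Im Imb] integral_Re[OF i] integral_Im[OF i]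
      by (simp add: complex_eq_iff)
    with i show ?thesis by (simp add: has_bochner_integral_iff)
  qed
  let ?R = "\<lambda>x. balanced_exp t (X n x) - 1 - \<i> * complex_of_real (t * X n x)"
  have bound: "cmod (H x * ?R x) \<le> C * exp (t\<^sup>2 / 2 * (K + 1)) * cubic_weight (X n x)" for x
  proof -
    have "cmod (H x * ?R x) \<le> exp (t\<^sup>2 / 2 * (K + 1)) * (C * cubic_weight (X n x))"
      unfolding norm_mult using Hb C by (intro mult_mono) auto
    then show ?thesis by (simp add: mult_ac)
  qed
  have W: "integrable M (\<lambda>x. C * exp (t\<^sup>2 / 2 * (K + 1)) * cubic_weight (X n x))"
    using Wint by simp
  have Rint: "integrable M (\<lambda>x. H x * ?R x)"
    by (rule Bochner_Integration.integrable_bound[OF W])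
      (auto intro!: AE_I2 order_trans[OF bound[simplified]])
  have "P (Suc n) x - P n x = H x * ?R x + (\<i> * complex_of_real t) * (H x * complex_of_real (X n x))" for x
    by (simp add: P_def H_def algebra_simps)
  then have "expectation (\<lambda>x. P (Suc n) x - P n x)
      = expectation (\<lambda>x. H x * ?R x + (\<i> * complex_of_real t) * (H x * complex_of_real (X n x)))"
    by simp
  also have "\<dots> = expectation (\<lambda>x. H x * ?R x)"
    using HX Rint by (subst Bochner_Integration.integral_add) (auto simp: has_bochner_integral_iff)
  finally have step: "expectation (P (Suc n)) - expectation (P n) = expectation (\<lambda>x. H x * ?R x)"
    using Pint by simp
  have "cmod (expectation (\<lambda>x. H x * ?R x)) \<le> expectation (\<lambda>x. cmod (H x * ?R x))"
    by (rule integral_norm_bound)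
  also have "\<dots> \<le> expectation (\<lambda>x. C * exp (t\<^sup>2 / 2 * (K + 1)) * cubic_weight (X n x))"
    using Rint W bound by (intro integral_mono) auto
  also have "\<dots> = C * exp (t\<^sup>2 / 2 * (K + 1)) * expectation (\<lambda>x. cubic_weight (X n x))" by simp
  finally have "cmod (expectation (P (Suc n)) - expectation (P n))
      \<le> C * exp (t\<^sup>2 / 2 * (K + 1)) * expectation (\<lambda>x. cubic_weight (X n x))"
    unfolding step .
  then show ?case
    using Suc.IH norm_triangle_ineq[of "expectation (P (Suc n)) - expectation (P n)" "expectation (P n) - 1"]
    by (simp add: P_def[abs_def] distrib_left)
qed

text \<open>
  Compare \<open>exp (\<i> t S)\<close> pathwise with the stopped product, rescaled by
  \<open>exp (- t\<^sup>2 c\<^sup>2 / 2)\<close>, and then use that the mean of the product is nearly one. The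
  bound is not asymptotic and thus applies to every row of an array with the same constant.
\<close>

lemma (in prob_space) martingale_difference_char_bound:
  fixes X :: "nat \<Rightarrow> 'a \<Rightarrow> real" and G :: "nat \<Rightarrow> 'a measure" and c :: real
  assumes sub: "\<And>k. subalgebra M (G k)" and nested: "\<And>k. sets (G k) \<subseteq> sets (G (Suc k))"
    and adapted: "\<And>k. X k \<in> borel_measurable (G (Suc k))"
    and sq: "\<And>k. integrable M (\<lambda>x. (X k x)\<^sup>2)"
    and mds: "\<And>k. AE x in M. real_cond_exp M (G k) (X k) x = 0"
    and C: "\<And>y. cmod (balanced_exp t y - 1 - \<i> * complex_of_real (t * y)) \<le> C * cubic_weight y"
  shows "cmod (expectation (\<lambda>x. iexp (t * (\<Sum>k<n. X k x))) - exp (- (t\<^sup>2 * c\<^sup>2) / 2))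
    \<le> (t\<^sup>2 / 2 * exp (t\<^sup>2 / 2) + 1 + exp (t\<^sup>2) + C * exp (t\<^sup>2))
      * (expectation (\<lambda>x. \<bar>(\<Sum>k<n. (X k x)\<^sup>2) - c\<^sup>2\<bar>)
         + (\<Sum>k<n. expectation (\<lambda>x. cubic_weight (X k x))))"
proof -
  let ?A = "t\<^sup>2 / 2 * exp (t\<^sup>2 / 2) + 1 + exp (t\<^sup>2)"
  let ?P = "\<lambda>x. stopped_prod t (c\<^sup>2 + 1) (\<lambda>k. X k x) n"
  let ?S = "\<lambda>x. iexp (t * (\<Sum>k<n. X k x))"
  let ?e = "exp (- (t\<^sup>2 * c\<^sup>2) / 2)"
  let ?V = "\<lambda>x. \<bar>(\<Sum>k<n. (X k x)\<^sup>2) - c\<^sup>2\<bar>"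
  let ?W = "\<Sum>k<n. expectation (\<lambda>x. cubic_weight (X k x))"
  have XM [measurable]: "X k \<in> borel_measurable M" for k
    using measurable_from_subalg[OF sub adapted] .
  have PM [measurable]: "(\<lambda>x. stopped_prod t (c\<^sup>2 + 1) (\<lambda>k. X k x) m) \<in> borel_measurable M" for m
    by (induction m) auto
  have Pint: "integrable M ?P"
    by (rule integrable_const_bound[OF AE_I2[OF norm_stopped_prod_le] PM]) auto
  have Sint: "integrable M ?S"
    by (rule integrable_const_bound[where B=1]) auto
  have Wint: "integrable M (\<lambda>x. cubic_weight (X k x))" for k
    by (rule Bochner_Integration.integrable_bound[OF sq[of k]])
      (auto simp: cubic_weight_nonneg cubic_weight_le_square)
  have Vint: "integrable M ?V" using sq by auto
  have W0: "0 \<le> ?W" by (simp add: sum_nonneg cubic_weight_nonneg)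
  have V0: "0 \<le> expectation ?V" by simp
  have C0: "0 \<le> C" using order_trans[OF norm_ge_zero C[of 1]] by (simp add: cubic_weight_def)
  have "cmod (expectation (\<lambda>x. ?S x - ?e * ?P x)) \<le> expectation (\<lambda>x. cmod (?S x - ?e * ?P x))"
    by (rule integral_norm_bound)
  also have "\<dots> \<le> expectation (\<lambda>x. ?A * (?V x + (\<Sum>k<n. cubic_weight (X k x))))"
    using Sint Pint Vint Wint stopped_prod_approximates
    by (intro integral_mono) auto
  also have "\<dots> = ?A * (expectation ?V + ?W)"
    using Vint Wint by simp
  finally have 1: "cmod (expectation ?S - ?e * expectation ?P) \<le> ?A * (expectation ?V + ?W)"
    using Sint Pint by simp
  have "cmod (expectation ?P - 1) \<le> C * exp (t\<^sup>2 / 2 * (c\<^sup>2 + 1 + 1)) * ?W"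
    by (rule expectation_stopped_prod[where G=G]) (simp_all add: assms C[simplified])
  then have "?e * cmod (expectation ?P - 1) \<le> ?e * (C * exp (t\<^sup>2 / 2 * (c\<^sup>2 + 1 + 1)) * ?W)"
    by (intro mult_left_mono) auto
  also have "\<dots> = C * (?e * exp (t\<^sup>2 / 2 * (c\<^sup>2 + 1 + 1))) * ?W" by (simp only: mult_ac)
  also have "?e * exp (t\<^sup>2 / 2 * (c\<^sup>2 + 1 + 1)) = exp (t\<^sup>2)"
    by (simp add: algebra_simps add_divide_distrib flip: exp_add)
  also have "C * exp (t\<^sup>2) * ?W \<le> C * exp (t\<^sup>2) * (expectation ?V + ?W)"
    using C0 V0 by (intro mult_left_mono) auto
  finally have "?e * cmod (expectation ?P - 1) \<le> C * exp (t\<^sup>2) * (expectation ?V + ?W)" .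
  moreover have "?e * expectation ?P - ?e = complex_of_real ?e * (expectation ?P - 1)"
    by (simp add: algebra_simps)
  ultimately have 2: "cmod (?e * expectation ?P - ?e) \<le> C * exp (t\<^sup>2) * (expectation ?V + ?W)"
    by (simp add: norm_mult)
  have "cmod (expectation ?S - ?e)
      \<le> cmod (expectation ?S - ?e * expectation ?P) + cmod (?e * expectation ?P - ?e)"
    using norm_triangle_ineq[of "expectation ?S - ?e * expectation ?P" "?e * expectation ?P - ?e"]
    by simp
  also have "\<dots> \<le> ?A * (expectation ?V + ?W) + C * exp (t\<^sup>2) * (expectation ?V + ?W)"
    using 1 2 by (rule add_mono)
  also have "\<dots> = (?A + C * exp (t\<^sup>2)) * (expectation ?V + ?W)"
    by (simp only: distrib_right)
  finally show ?thesis .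
qed

section \<open>Uniform integrability\<close>

lemma uniformly_integrable_tail:
  assumes ui: "uniformly_integrable I M X" and e: "0 < e"
  obtains K :: real where "0 < K"
    "\<And>i. i \<in> I \<Longrightarrow>
      (\<integral>\<^sup>+ x. ennreal \<bar>X i x\<bar> * indicator {x. K < \<bar>X i x\<bar>} x \<partial>M i) \<le> ennreal e"
proof -
  let ?T = "\<lambda>K i. \<integral>\<^sup>+ x. ennreal \<bar>X i x\<bar> * indicator {x. K < \<bar>X i x\<bar>} x \<partial>M i"
  have "((\<lambda>K. SUP i\<in>I. ?T K i) \<longlongrightarrow> 0) at_top"
    using ui by (simp add: uniformly_integrable_def)
  then have "\<forall>\<^sub>F K in at_top. (SUP i\<in>I. ?T K i) < ennreal e"
    using e by (intro order_tendstoD) auto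
  then have "\<forall>\<^sub>F K in at_top. (SUP i\<in>I. ?T K i) < ennreal e \<and> 0 < K"
    using eventually_gt_at_top by (rule eventually_conj)
  then obtain K where K: "(SUP i\<in>I. ?T K i) < ennreal e" "0 < K"
    using eventually_happens'[OF trivial_limit_at_top_linorder] by blast
  have "?T K i \<le> ennreal e" if "i \<in> I" for i
    using SUP_upper[OF that, of "?T K"] K(1) by simp
  with K(2) show ?thesis by (rule that)
qed

lemma (in prob_space) integrable_of_tail:
  fixes Y :: "'a \<Rightarrow> real"
  assumes Y [measurable]: "Y \<in> borel_measurable M" and nonneg: "\<And>x. 0 \<le> Y x"
    and K: "0 < K" and e: "0 \<le> e"
    and tail: "(\<integral>\<^sup>+ x. ennreal \<bar>Y x\<bar> * indicator {x. K < \<bar>Y x\<bar>} x \<partial>M) \<le> ennreal e"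
  shows "integrable M Y" "integrable M (\<lambda>x. if K < Y x then Y x else 0)"
    "expectation (\<lambda>x. if K < Y x then Y x else 0) \<le> e" "expectation Y \<le> K + e"
proof -
  let ?T = "\<lambda>x. if K < Y x then Y x else 0"
  have "(\<integral>\<^sup>+ x. ennreal (?T x) \<partial>M) = (\<integral>\<^sup>+ x. ennreal \<bar>Y x\<bar> * indicator {x. K < \<bar>Y x\<bar>} x \<partial>M)"
    by (intro nn_integral_cong) (auto simp: nonneg split: split_indicator)
  with tail have T: "(\<integral>\<^sup>+ x. ennreal (?T x) \<partial>M) \<le> ennreal e" by simp
  show Ti: "integrable M ?T"
    using T by (intro integrableI_nonneg) (auto simp: nonneg intro: le_less_trans)
  show le: "expectation ?T \<le> e"
    using T e nn_integral_eq_integral[OF Ti] by (simp add: nonneg)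
  have Y_le: "Y x \<le> K + ?T x" for x using K by auto
  show Yi: "integrable M Y"
    by (rule Bochner_Integration.integrable_bound[where f="\<lambda>x. K + ?T x"])
      (use Ti K nonneg Y_le in \<open>auto intro!: AE_I2\<close>)
  have "expectation Y \<le> expectation (\<lambda>x. K + ?T x)"
    using Yi Ti Y_le by (intro integral_mono) auto
  also have "\<dots> = K + expectation ?T" using Ti by (simp add: prob_space)
  finally show "expectation Y \<le> K + e" using le by simp
qed

section \<open>Stationarity and block averages\<close>

text \<open>
  Stationarity is an identity of laws on the path space. This is its form for integrals of
  functionals of the path.
\<close>

lemma strictly_stationary_shift:
  fixes f :: "(int \<Rightarrow> real) \<Rightarrow> real"
  assumes X: "strictly_stationary M X" and f: "f \<in> borel_measurable (\<Pi>\<^sub>M k\<in>UNIV. borel)"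
  shows "integrable M (\<lambda>x. f (\<lambda>k. X (k + h) x)) \<longleftrightarrow> integrable M (\<lambda>x. f (\<lambda>k. X k x))"
    "(\<integral>x. f (\<lambda>k. X (k + h) x) \<partial>M) = (\<integral>x. f (\<lambda>k. X k x) \<partial>M)"
proof -
  have Xm: "X k \<in> borel_measurable M" for k
    using X by (simp add: strictly_stationary_def)
  have m: "(\<lambda>x k. X (k + h) x) \<in> measurable M (\<Pi>\<^sub>M k\<in>UNIV. borel)" for h
    by (rule measurable_PiM_single') (auto simp: Xm)
  have d: "distr M (\<Pi>\<^sub>M k\<in>UNIV. borel) (\<lambda>x k. X (k + h) x) = distr M (\<Pi>\<^sub>M k\<in>UNIV. borel) (\<lambda>x k. X k x)"
    using X by (simp add: strictly_stationary_def)
  show "integrable M (\<lambda>x. f (\<lambda>k. X (k + h) x)) \<longleftrightarrow> integrable M (\<lambda>x. f (\<lambda>k. X k x))"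
    using integrable_distr_eq[OF m[of h] f] integrable_distr_eq[OF m[of 0] f] d by simp
  show "(\<integral>x. f (\<lambda>k. X (k + h) x) \<partial>M) = (\<integral>x. f (\<lambda>k. X k x) \<partial>M)"
    using integral_distr[OF m[of h] f] integral_distr[OF m[of 0] f] d by simp
qed

lemma strictly_stationary_marginal:
  fixes g :: "real \<Rightarrow> real"
  assumes X: "strictly_stationary M X" and g [measurable]: "g \<in> borel_measurable borel"
  shows "integrable M (\<lambda>x. g (X k x)) \<longleftrightarrow> integrable M (\<lambda>x. g (X 1 x))"
    "(\<integral>x. g (X k x) \<partial>M) = (\<integral>x. g (X 1 x) \<partial>M)"
proof -
  have f: "(\<lambda>w. g (w 1)) \<in> borel_measurable (\<Pi>\<^sub>M k\<in>(UNIV :: int set). borel)" by measurable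
  show "integrable M (\<lambda>x. g (X k x)) \<longleftrightarrow> integrable M (\<lambda>x. g (X 1 x))"
    "(\<integral>x. g (X k x) \<partial>M) = (\<integral>x. g (X 1 x) \<partial>M)"
    using strictly_stationary_shift[OF X f, of "k - 1"] by simp_all
qed

lemma strictly_stationary_compose:
  assumes X: "strictly_stationary M X" and g [measurable]: "g \<in> borel_measurable borel"
  shows "strictly_stationary M (\<lambda>k x. g (X k x))"
proof -
  have Xm: "X k \<in> borel_measurable M" for k
    using X by (simp add: strictly_stationary_def)
  have m: "(\<lambda>x k. X (k + h) x) \<in> measurable M (\<Pi>\<^sub>M k\<in>UNIV. borel)" for h
    by (rule measurable_PiM_single') (auto simp: Xm)
  have G: "(\<lambda>w k. g (w k)) \<in> measurable (\<Pi>\<^sub>M k\<in>UNIV. borel) (\<Pi>\<^sub>M k\<in>UNIV. borel)"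
    for k :: int by (rule measurable_PiM_single') auto
  have "distr M (\<Pi>\<^sub>M k\<in>UNIV. borel) (\<lambda>x k. g (X (k + h) x))
      = distr (distr M (\<Pi>\<^sub>M k\<in>UNIV. borel) (\<lambda>x k. X (k + h) x)) (\<Pi>\<^sub>M k\<in>UNIV. borel) (\<lambda>w k. g (w k))" for h
    by (simp add: distr_distr[OF G m] comp_def)
  moreover have "distr M (\<Pi>\<^sub>M k\<in>UNIV. borel) (\<lambda>x k. X (k + h) x)
      = distr M (\<Pi>\<^sub>M k\<in>UNIV. borel) (\<lambda>x k. X (k + 0) x)" for h
    using X by (simp add: strictly_stationary_def)
  ultimately have "distr M (\<Pi>\<^sub>M k\<in>UNIV. borel) (\<lambda>x k. g (X (k + h) x))
      = distr M (\<Pi>\<^sub>M k\<in>UNIV. borel) (\<lambda>x k. g (X (k + 0) x))" for h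
    by metis
  then show ?thesis
    unfolding strictly_stationary_def using Xm by auto
qed

lemma subadditive_nat_le:
  fixes u :: "nat \<Rightarrow> real"
  assumes "u 0 = 0" and "\<And>a b. u (a + b) \<le> u a + u b"
  shows "u (q * m) \<le> real q * u m"
proof (induction q)
  case (Suc q)
  have "u (Suc q * m) \<le> u m + u (q * m)" using assms(2)[of m "q * m"] by simp
  then show ?case using Suc by (simp add: algebra_simps)
qed (simp add: assms(1))

text \<open>
  The mean absolute deviation of the sum over \<open>n\<close> consecutive indices depends only on \<open>n\<close> and is
  subadditive in it. Hence \<open>n div m\<close> blocks of length \<open>m\<close> and a remainder of fewer
  than \<open>m\<close> single terms bound it.
\<close>

lemma (in prob_space) stationary_average_le_block_average:
  fixes Y :: "int \<Rightarrow> 'a \<Rightarrow> real"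
  assumes Y: "strictly_stationary M Y" and int: "integrable M (Y 1)"
    and m: "1 \<le> m" and n: "1 \<le> n"
  shows "expectation (\<lambda>x. \<bar>(1 / real n) * (\<Sum>j=1..n. Y (int j) x) - a\<bar>)
    \<le> expectation (\<lambda>x. \<bar>(1 / real m) * (\<Sum>j=1..m. Y (int j) x) - a\<bar>)
      + real m * (expectation (\<lambda>x. \<bar>Y 1 x\<bar>) + \<bar>a\<bar>) / real n"
proof -
  define u where "u n = expectation (\<lambda>x. \<bar>\<Sum>j<n. (Y (int j + 1) x - a)\<bar>)" for n :: nat
  have Yi: "integrable M (Y k)" for k
    using strictly_stationary_marginal(1)[OF Y, of "\<lambda>y. y" k] int by simp
  have u0: "u 0 = 0" by (simp add: u_def)
  have sub: "u (p + q) \<le> u p + u q" for p q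
  proof -
    have split: "(\<Sum>j<p + q. f j) = (\<Sum>j<p. f j) + (\<Sum>j<q. f (j + p))" for f :: "nat \<Rightarrow> real"
      by (induction q) (auto simp: add_ac)
    have "u (p + q) = expectation (\<lambda>x. \<bar>(\<Sum>j<p. (Y (int j + 1) x - a)) + (\<Sum>j<q. (Y (int j + 1 + int p) x - a))\<bar>)"
      unfolding u_def split by (simp add: add_ac)
    also have "\<dots> \<le> expectation (\<lambda>x. \<bar>\<Sum>j<p. (Y (int j + 1) x - a)\<bar> + \<bar>\<Sum>j<q. (Y (int j + 1 + int p) x - a)\<bar>)"
      using Yi by (intro integral_mono) auto
    also have "\<dots> = u p + expectation (\<lambda>x. \<bar>\<Sum>j<q. (Y (int j + 1 + int p) x - a)\<bar>)"
      unfolding u_def using Yi by (subst Bochner_Integration.integral_add) auto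
    also have "expectation (\<lambda>x. \<bar>\<Sum>j<q. (Y (int j + 1 + int p) x - a)\<bar>) = u q"
      unfolding u_def
      by (rule strictly_stationary_shift(2)[OF Y, of "\<lambda>w. \<bar>\<Sum>j<q. (w (int j + 1) - a)\<bar>"]) measurable
    finally show ?thesis .
  qed
  have u_avg: "expectation (\<lambda>x. \<bar>(1 / real k) * (\<Sum>j=1..k. Y (int j) x) - a\<bar>) = u k / real k"
    if k: "1 \<le> k" for k
  proof -
    have "\<bar>(1 / real k) * (\<Sum>j=1..k. Y (int j) x) - a\<bar> = \<bar>\<Sum>j<k. (Y (int j + 1) x - a)\<bar> / real k" for x
    proof -
      have "(\<Sum>j=1..k. Y (int j) x) = (\<Sum>j<k. Y (int j + 1) x)"
        by (rule sum.reindex_bij_witness[of _ "\<lambda>j. j + 1" "\<lambda>j. j - 1"]) (auto simp: of_nat_diff)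
      then have "(1 / real k) * (\<Sum>j=1..k. Y (int j) x) - a = (\<Sum>j<k. (Y (int j + 1) x - a)) / real k"
        using k by (simp add: sum_subtractf field_simps)
      then show ?thesis by simp
    qed
    then show ?thesis by (simp add: u_def)
  qed
  let ?B = "expectation (\<lambda>x. \<bar>Y 1 x\<bar>) + \<bar>a\<bar>"
  have u1: "u 1 \<le> ?B"
  proof -
    have "u 1 \<le> expectation (\<lambda>x. \<bar>Y 1 x\<bar> + \<bar>a\<bar>)"
      unfolding u_def using Yi by (intro integral_mono) auto
    then show ?thesis using Yi by (simp add: prob_space)
  qed
  have um: "0 \<le> u k" for k unfolding u_def by simp
  have B: "0 \<le> ?B" using u1 um[of 1] by linarith
  have "u n = u ((n div m) * m + n mod m)" by simp
  also have "\<dots> \<le> u ((n div m) * m) + u (n mod m)" by (rule sub)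
  also have "\<dots> \<le> real (n div m) * u m + real (n mod m) * u 1"
    using subadditive_nat_le[OF u0 sub, of "n mod m" 1] by (intro add_mono subadditive_nat_le[OF u0 sub]) simp
  also have "\<dots> \<le> (real n / real m) * u m + real m * ?B"
    using m u1 um[of m] um[of 1] B
    by (intro add_mono mult_mono) (auto simp: of_nat_div_le_of_nat less_imp_le)
  finally have "u n / real n \<le> ((real n / real m) * u m + real m * ?B) / real n"
    by (rule divide_right_mono) simp
  also have "\<dots> = u m / real m + real m * ?B / real n"
    using n by (simp add: add_divide_distrib)
  finally show ?thesis using u_avg[OF n] u_avg[OF m] by simp
qed

section \<open>Block averages in the limit\<close>

text \<open>
  The function of the block under the mean is continuous but unbounded. Truncating the squares at a
  level \<open>K\<close> makes it a test function for convergence in distribution. The cost of the truncation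
  is uniform in \<open>n\<close> by uniform integrability, and for the limit it vanishes as \<open>K\<close> grows
  by dominated convergence.
\<close>

lemma second_moment_block_limit:
  fixes X :: "nat \<Rightarrow> nat \<Rightarrow> 'a \<Rightarrow> real" and L :: "nat \<Rightarrow> 'b \<Rightarrow> real"
  assumes prob: "\<And>n. 1 \<le> n \<Longrightarrow> prob_space (M n)" and N: "prob_space N"
    and m: "1 \<le> m"
    and conv: "vec_conv_in_distr {1..m} M X N L"
    and Xm: "\<And>n j. 1 \<le> n \<Longrightarrow> j \<in> {1..m} \<Longrightarrow> X n j \<in> borel_measurable (M n)"
    and Xi: "\<And>n j. 1 \<le> n \<Longrightarrow> j \<in> {1..m} \<Longrightarrow> integrable (M n) (\<lambda>x. (X n j x)\<^sup>2)"
    and ui: "\<And>e. 0 < e \<Longrightarrow> \<exists>K. 0 < K \<and> (\<forall>n\<ge>1. \<forall>j\<in>{1..m}.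
        (\<integral>x. (if K < (X n j x)\<^sup>2 then (X n j x)\<^sup>2 else 0) \<partial>M n) \<le> e)"
    and Lm: "\<And>j. j \<in> {1..m} \<Longrightarrow> L j \<in> borel_measurable N"
    and Li: "\<And>j. j \<in> {1..m} \<Longrightarrow> integrable N (\<lambda>y. (L j y)\<^sup>2)"
    and e: "0 < e"
  shows "\<forall>\<^sub>F n in sequentially. (\<integral>x. \<bar>(1 / real m) * (\<Sum>j=1..m. (X n j x)\<^sup>2) - a\<bar> \<partial>M n)
    \<le> (\<integral>y. \<bar>(1 / real m) * (\<Sum>j=1..m. (L j y)\<^sup>2) - a\<bar> \<partial>N) + e"
proof -
  interpret N: prob_space N by fact
  \<comment> \<open>Three errors of size \<open>e / 3\<close>: truncation for the array, truncation for the limit, and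
    convergence in distribution.\<close>
  define f where "f K w = \<bar>(1 / real m) * (\<Sum>j=1..m. min ((w j)\<^sup>2) K) - a\<bar>"
    for K and w :: "nat \<Rightarrow> real"
  define g where "g w = \<bar>(1 / real m) * (\<Sum>j=1..m. (w j)\<^sup>2) - a\<bar>" for w :: "nat \<Rightarrow> real"
  obtain K0 where K0: "0 < K0" "\<And>n j. 1 \<le> n \<Longrightarrow> j \<in> {1..m} \<Longrightarrow>
      (\<integral>x. (if K0 < (X n j x)\<^sup>2 then (X n j x)\<^sup>2 else 0) \<partial>M n) \<le> e / 3"
    using ui[of "e / 3"] e by auto
  have f_bound: "\<bar>f K w\<bar> \<le> K + \<bar>a\<bar>" if K: "0 \<le> K" for K w
  proof -
    have "(\<Sum>j=1..m. min ((w j)\<^sup>2) K) \<le> (\<Sum>j=1..m. K)" by (intro sum_mono) auto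
    then have "(1 / real m) * (\<Sum>j=1..m. min ((w j)\<^sup>2) K) \<le> K"
      using m by (simp add: field_simps)
    moreover have "0 \<le> (1 / real m) * (\<Sum>j=1..m. min ((w j)\<^sup>2) K)"
      using K by (intro mult_nonneg_nonneg sum_nonneg) auto
    ultimately show ?thesis unfolding f_def by linarith
  qed
  have Lg: "integrable N (\<lambda>y. g (\<lambda>j. L j y))"
    unfolding g_def using Li
      by (intro integrable_abs Bochner_Integration.integrable_diff integrable_mult_right
          Bochner_Integration.integrable_sum) auto
  have fm: "(\<lambda>y. f K (\<lambda>j. L j y)) \<in> borel_measurable N" for K
    unfolding f_def using Lm by measurable
  have "(\<lambda>i. \<integral>y. f (real i) (\<lambda>j. L j y) \<partial>N) \<longlonglongrightarrow> (\<integral>y. g (\<lambda>j. L j y) \<partial>N)"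
  proof (rule integral_dominated_convergence[where w="\<lambda>y. (1 / real m) * (\<Sum>j=1..m. (L j y)\<^sup>2) + \<bar>a\<bar>"])
    show "AE y in N. (\<lambda>i. f (real i) (\<lambda>j. L j y)) \<longlonglongrightarrow> g (\<lambda>j. L j y)"
    proof (rule AE_I2)
      fix y
      have "(\<lambda>i. min ((L j y)\<^sup>2) (real i)) \<longlonglongrightarrow> (L j y)\<^sup>2" for j
      proof (rule tendsto_eventually)
        obtain i0 where i0: "(L j y)\<^sup>2 \<le> real i0" using real_arch_simple by blast
        show "\<forall>\<^sub>F i in sequentially. min ((L j y)\<^sup>2) (real i) = (L j y)\<^sup>2"
          using eventually_ge_at_top[of i0]
        proof eventually_elim
          case (elim i)
          then have "real i0 \<le> real i" by simp
          with i0 show ?case by (simp add: min_def)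
        qed
      qed
      then show "(\<lambda>i. f (real i) (\<lambda>j. L j y)) \<longlonglongrightarrow> g (\<lambda>j. L j y)"
        unfolding f_def g_def by (intro tendsto_intros)
    qed
    show "AE y in N. norm (f (real i) (\<lambda>j. L j y)) \<le> (1 / real m) * (\<Sum>j=1..m. (L j y)\<^sup>2) + \<bar>a\<bar>" for i
    proof (rule AE_I2)
      fix y
      have "(1 / real m) * (\<Sum>j=1..m. min ((L j y)\<^sup>2) (real i)) \<le> (1 / real m) * (\<Sum>j=1..m. (L j y)\<^sup>2)"
        by (intro mult_left_mono sum_mono) auto
      moreover have "0 \<le> (1 / real m) * (\<Sum>j=1..m. min ((L j y)\<^sup>2) (real i))"
        by (intro mult_nonneg_nonneg sum_nonneg) auto
      ultimately show "norm (f (real i) (\<lambda>j. L j y)) \<le> (1 / real m) * (\<Sum>j=1..m. (L j y)\<^sup>2) + \<bar>a\<bar>"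
        unfolding f_def real_norm_def by linarith
    qed
    show "integrable N (\<lambda>y. (1 / real m) * (\<Sum>j=1..m. (L j y)\<^sup>2) + \<bar>a\<bar>)"
      using Li by (intro Bochner_Integration.integrable_add integrable_mult_right
          Bochner_Integration.integrable_sum) auto
  qed (use Lg fm in auto)
  then have "\<forall>\<^sub>F i in sequentially. (\<integral>y. f (real i) (\<lambda>j. L j y) \<partial>N) < (\<integral>y. g (\<lambda>j. L j y) \<partial>N) + e / 3"
    using e by (intro order_tendstoD) auto
  moreover have "\<forall>\<^sub>F i in sequentially. K0 \<le> real i"
    using real_arch_simple[of K0] eventually_ge_at_top
    by (metis (mono_tags, lifting) eventually_sequentially of_nat_le_iff order_trans)
  ultimately obtain i where i: "(\<integral>y. f (real i) (\<lambda>j. L j y) \<partial>N) < (\<integral>y. g (\<lambda>j. L j y) \<partial>N) + e / 3"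
    "K0 \<le> real i"
    using eventually_happens'[OF sequentially_bot eventually_conj] by blast
  define K where "K = real i"
  have K: "0 < K" "K0 \<le> K" using K0(1) i(2) by (auto simp: K_def)
  have "continuous_map (powertop_real {1..m}) euclideanreal (f K)"
    unfolding f_def by (intro continuous_intros) auto
  moreover have "bounded (f K ` topspace (powertop_real {1..m}))"
    unfolding bounded_iff using f_bound K(1) by (intro exI[of _ "K + \<bar>a\<bar>"]) auto
  ultimately have "(\<lambda>n. \<integral>x. f K (\<lambda>j\<in>{1..m}. X n j x) \<partial>M n)
      \<longlonglongrightarrow> (\<integral>y. f K (\<lambda>j\<in>{1..m}. L j y) \<partial>N)"
    using conv unfolding vec_conv_in_distr_def by blast
  then have "(\<lambda>n. \<integral>x. f K (\<lambda>j. X n j x) \<partial>M n) \<longlonglongrightarrow> (\<integral>y. f K (\<lambda>j. L j y) \<partial>N)"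
    by (simp add: f_def cong: sum.cong_simp)
  then have "\<forall>\<^sub>F n in sequentially. (\<integral>x. f K (\<lambda>j. X n j x) \<partial>M n) < (\<integral>y. f K (\<lambda>j. L j y) \<partial>N) + e / 3"
    using e by (intro order_tendstoD) auto
  then have "\<forall>\<^sub>F n in sequentially. (\<integral>x. g (\<lambda>j. X n j x) \<partial>M n) \<le> (\<integral>y. g (\<lambda>j. L j y) \<partial>N) + e"
    using eventually_ge_at_top[of 1]
  proof eventually_elim
    case (elim n)
    interpret prob_space "M n" using prob elim(2) .
    let ?T = "\<lambda>j x. if K0 < (X n j x)\<^sup>2 then (X n j x)\<^sup>2 else 0"
    note Xm' = Xm[OF elim(2)] and Xi' = Xi[OF elim(2)]
    have Ti: "integrable (M n) (?T j)" if "j \<in> {1..m}" for j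
      using that Xm'[OF that]
      by (intro Bochner_Integration.integrable_bound[OF Xi'[OF that]]) auto
    have fi: "integrable (M n) (\<lambda>x. f K (\<lambda>j. X n j x))"
    proof (rule integrable_const_bound[where B="K + \<bar>a\<bar>"])
      show "(\<lambda>x. f K (\<lambda>j. X n j x)) \<in> borel_measurable (M n)"
        unfolding f_def using Xm' by measurable
    qed (use f_bound K(1) in auto)
    have gi: "integrable (M n) (\<lambda>x. g (\<lambda>j. X n j x))"
      unfolding g_def using Xi'
      by (intro integrable_abs Bochner_Integration.integrable_diff integrable_mult_right
          Bochner_Integration.integrable_sum) auto
    have "g (\<lambda>j. X n j x) \<le> f K (\<lambda>j. X n j x) + (1 / real m) * (\<Sum>j=1..m. ?T j x)" for x
    proof -
      have "(\<Sum>j=1..m. (X n j x)\<^sup>2) \<le> (\<Sum>j=1..m. min ((X n j x)\<^sup>2) K + ?T j x)"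
        using K by (intro sum_mono) auto
      then have "(1 / real m) * (\<Sum>j=1..m. (X n j x)\<^sup>2)
          \<le> (1 / real m) * ((\<Sum>j=1..m. min ((X n j x)\<^sup>2) K) + (\<Sum>j=1..m. ?T j x))"
        unfolding sum.distrib by (intro mult_left_mono) auto
      moreover have "(1 / real m) * (\<Sum>j=1..m. min ((X n j x)\<^sup>2) K) \<le> (1 / real m) * (\<Sum>j=1..m. (X n j x)\<^sup>2)"
        by (intro mult_left_mono sum_mono) auto
      ultimately show ?thesis unfolding f_def g_def distrib_left by linarith
    qed
    then have "(\<integral>x. g (\<lambda>j. X n j x) \<partial>M n) \<le> (\<integral>x. f K (\<lambda>j. X n j x) + (1 / real m) * (\<Sum>j=1..m. ?T j x) \<partial>M n)"
      using gi fi Ti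
      by (intro integral_mono Bochner_Integration.integrable_add integrable_mult_right
          Bochner_Integration.integrable_sum) auto
    also have "\<dots> = (\<integral>x. f K (\<lambda>j. X n j x) \<partial>M n) + (1 / real m) * (\<Sum>j=1..m. \<integral>x. ?T j x \<partial>M n)"
      using fi Ti
      by (subst Bochner_Integration.integral_add)
        (auto simp: Bochner_Integration.integral_sum
          intro!: integrable_divide_zero Bochner_Integration.integrable_sum)
    also have "(1 / real m) * (\<Sum>j=1..m. \<integral>x. ?T j x \<partial>M n) \<le> (1 / real m) * (\<Sum>j=1..m. e / 3)"
      using K0(2)[OF elim(2)] by (intro mult_left_mono sum_mono) auto
    also have "\<dots> = e / 3" using m by simp
    finally show ?case using elim(1) i(1) by (simp add: K_def)
  qed
  then show ?thesis by (simp add: g_def)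
qed

section \<open>The central limit theorem\<close>

text \<open>
  Stationarity collapses the total cubic weight of the scaled row to a single expectation, which is
  a Lindeberg term for \<open>D 1\<close>.
\<close>

lemma (in prob_space) stationary_martingale_char_bound:
  fixes D :: "int \<Rightarrow> 'a \<Rightarrow> real" and c :: real
  assumes F: "nested_filtration M F" and D: "martingale_difference M F D"
    and st: "strictly_stationary M D" and sq: "integrable M (\<lambda>x. (D 1 x)\<^sup>2)" and n: "1 \<le> n"
    and C: "\<And>y. cmod (balanced_exp t y - 1 - \<i> * complex_of_real (t * y)) \<le> C * cubic_weight y"
  shows "cmod (char (distr M borel (\<lambda>x. (1 / sqrt (real n)) * (\<Sum>k=1..int n. D k x))) t
      - exp (- (t\<^sup>2 * c\<^sup>2) / 2))
    \<le> (t\<^sup>2 / 2 * exp (t\<^sup>2 / 2) + 1 + exp (t\<^sup>2) + C * exp (t\<^sup>2))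
      * (expectation (\<lambda>x. \<bar>(1 / real n) * (\<Sum>j=1..n. (D (int j) x)\<^sup>2) - c\<^sup>2\<bar>)
         + expectation (\<lambda>x. (D 1 x)\<^sup>2 * min 1 (\<bar>D 1 x\<bar> / sqrt (real n))))"
proof -
  let ?X = "\<lambda>k x. (1 / sqrt (real n)) * D (int k + 1) x"
  have sub: "subalgebra M (F k)" and nest: "sets (F k) \<subseteq> sets (F (k + 1))" for k
    using F by (auto simp: nested_filtration_def)
  have Di: "integrable M (D k)" and Dm: "D k \<in> borel_measurable (F k)"
    and mds: "AE x in M. real_cond_exp M (F (k - 1)) (D k) x = 0" for k
    using D by (auto simp: martingale_difference_def)
  have DM [measurable]: "D k \<in> borel_measurable M" for k
    using Di by auto
  have sqk: "integrable M (\<lambda>x. (D k x)\<^sup>2)" for k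
    using strictly_stationary_marginal(1)[OF st, of "\<lambda>y. y\<^sup>2" k] sq by simp
  have Xmds: "AE x in M. real_cond_exp M (F (int k)) (?X k) x = 0" for k
  proof -
    interpret S: finite_measure_subalgebra M "F (int k)" by unfold_locales (rule sub)
    show ?thesis
      using S.real_cond_exp_cmult[OF Di[of "int k + 1"], of "1 / sqrt (real n)"] mds[of "int k + 1"]
      by auto
  qed
  have reindex: "(\<Sum>j=1..n. f (int j)) = (\<Sum>k<n. f (int k + 1))"
    "(\<Sum>j=1..int n. f j) = (\<Sum>k<n. f (int k + 1))" for f :: "int \<Rightarrow> real"
    by (rule sum.reindex_bij_witness[of _ "\<lambda>j. j + 1" "\<lambda>j. j - 1"], auto simp: of_nat_diff)
      (rule sum.reindex_bij_witness[of _ "\<lambda>j. int j + 1" "\<lambda>j. nat (j - 1)"], auto)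
  have char: "char (distr M borel (\<lambda>x. (1 / sqrt (real n)) * (\<Sum>k=1..int n. D k x))) t
      = expectation (\<lambda>x. iexp (t * (\<Sum>k<n. ?X k x)))"
    by (simp add: char_def integral_distr reindex(2) sum_distrib_left)
  have V: "(\<Sum>k<n. (?X k x)\<^sup>2) = (1 / real n) * (\<Sum>j=1..n. (D (int j) x)\<^sup>2)" for x
    unfolding reindex(1)[of "\<lambda>j. (D j x)\<^sup>2"]
    by (simp add: power_mult_distrib power_divide sum_divide_distrib)
  have W: "(\<Sum>k<n. expectation (\<lambda>x. cubic_weight (?X k x)))
      = expectation (\<lambda>x. (D 1 x)\<^sup>2 * min 1 (\<bar>D 1 x\<bar> / sqrt (real n)))"
  proof -
    have "(\<Sum>k<n. expectation (\<lambda>x. cubic_weight (?X k x)))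
        = (\<Sum>k<n. expectation (\<lambda>x. cubic_weight ((1 / sqrt (real n)) * D 1 x)))"
      using strictly_stationary_marginal(2)[OF st, of "\<lambda>y. cubic_weight ((1 / sqrt (real n)) * y)"]
      by (intro sum.cong) auto
    also have "\<dots> = expectation (\<lambda>x. real n * cubic_weight ((1 / sqrt (real n)) * D 1 x))" by simp
    also have "\<dots> = expectation (\<lambda>x. (D 1 x)\<^sup>2 * min 1 (\<bar>D 1 x\<bar> / sqrt (real n)))"
      using n by (intro Bochner_Integration.integral_cong) (auto simp: cubic_weight_def power_divide abs_mult)
    finally show ?thesis .
  qed
  have "cmod (expectation (\<lambda>x. iexp (t * (\<Sum>k<n. ?X k x))) - exp (- (t\<^sup>2 * c\<^sup>2) / 2))
    \<le> (t\<^sup>2 / 2 * exp (t\<^sup>2 / 2) + 1 + exp (t\<^sup>2) + C * exp (t\<^sup>2))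
      * (expectation (\<lambda>x. \<bar>(\<Sum>k<n. (?X k x)\<^sup>2) - c\<^sup>2\<bar>)
         + (\<Sum>k<n. expectation (\<lambda>x. cubic_weight (?X k x))))"
  proof (rule martingale_difference_char_bound[where G="\<lambda>k. F (int k)"])
    show "sets (F (int k)) \<subseteq> sets (F (int (Suc k)))" for k
      using nest[of "int k"] by (simp add: add.commute)
    show "?X k \<in> borel_measurable (F (int (Suc k)))" for k
      using Dm[of "int k + 1"] by (simp add: add.commute)
    show "integrable M (\<lambda>x. (?X k x)\<^sup>2)" for k
      using sqk[of "int k + 1"] by (simp add: power_mult_distrib power_divide)
  qed (rule sub Xmds C)+
  then show ?thesis unfolding char V W .
qed

text \<open>
  This splits the Lindeberg term at the level \<open>K\<close> of uniform integrability: the tail is small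
  uniformly in the row, and the rest vanishes as \<open>s = sqrt n\<close> grows.
\<close>

lemma square_min_le_tail:
  fixes y :: real
  assumes "0 < K" "0 < s"
  shows "y\<^sup>2 * min 1 (\<bar>y\<bar> / s) \<le> (if K < y\<^sup>2 then y\<^sup>2 else 0) + K * sqrt K / s"
proof (cases "K < y\<^sup>2")
  case True
  have "y\<^sup>2 * min 1 (\<bar>y\<bar> / s) \<le> y\<^sup>2 * 1" by (intro mult_left_mono) auto
  then show ?thesis using True assms by (simp add: add_increasing2)
next
  case False
  then have "\<bar>y\<bar> \<le> sqrt K" by (intro real_le_rsqrt) simp
  then have "y\<^sup>2 * min 1 (\<bar>y\<bar> / s) \<le> K * (sqrt K / s)"
    using False assms by (intro mult_mono) (auto simp: min_le_iff_disj intro: divide_right_mono)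
  then show ?thesis using False by simp
qed

theorem theorem8:
  fixes M :: "nat \<Rightarrow> 'a measure"
    and F :: "nat \<Rightarrow> int \<Rightarrow> 'a measure"
    and D :: "nat \<Rightarrow> int \<Rightarrow> 'a \<Rightarrow> real"
    and N :: "'b measure"
    and L :: "nat \<Rightarrow> 'b \<Rightarrow> real"
    and c :: real
  assumes "\<And>n. n \<ge> 1 \<Longrightarrow> prob_space (M n)"
    and "\<And>n. n \<ge> 1 \<Longrightarrow> nested_filtration (M n) (F n)"
    and "\<And>n. n \<ge> 1 \<Longrightarrow> stationary_filtration (M n) (F n)"
    and "\<And>n. n \<ge> 1 \<Longrightarrow> martingale_difference (M n) (F n) (D n)"
    and "\<And>n. n \<ge> 1 \<Longrightarrow> strictly_stationary (M n) (D n)"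
    and "uniformly_integrable {1..} M (\<lambda>n x. (D n 1 x)\<^sup>2)"
    and "prob_space N"
    and "\<And>j. j \<ge> 1 \<Longrightarrow> L j \<in> borel_measurable N"
    and "\<And>m. m \<ge> 1 \<Longrightarrow> vec_conv_in_distr {1..m} M (\<lambda>n j. D n (int j)) N L"
    and "L1_tendsto_const N (\<lambda>m y. (1 / real m) * (\<Sum>j=1..m. (L j y)\<^sup>2)) (c\<^sup>2)"
  shows "weak_conv_m
           (\<lambda>n. distr (M n) borel (\<lambda>x. (1 / sqrt (real n)) * (\<Sum>k=1..int n. D n k x)))
           (distr std_normal_distribution borel (\<lambda>z. c * z))"
proof -
  note prob = assms(1) and filt = assms(2) and mds = assms(4) and stat = assms(5)
  let ?\<mu> = "\<lambda>n. distr (M n) borel (\<lambda>x. (1 / sqrt (real n)) * (\<Sum>k=1..int n. D n k x))"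
  let ?\<nu> = "distr std_normal_distribution borel (\<lambda>z. c * z)"
  let ?T = "\<lambda>K y. if K < y\<^sup>2 then y\<^sup>2 else (0::real)"
  define \<Delta> where "\<Delta> n = (\<integral>x. \<bar>(1 / real n) * (\<Sum>j=1..n. (D n (int j) x)\<^sup>2) - c\<^sup>2\<bar> \<partial>M n)" for n
  define \<Lambda> where "\<Lambda> n = (\<integral>x. (D n 1 x)\<^sup>2 * min 1 (\<bar>D n 1 x\<bar> / sqrt (real n)) \<partial>M n)" for n
  have Dm: "D n k \<in> borel_measurable (M n)" if "1 \<le> n" for n k
    using stat[OF that] by (simp add: strictly_stationary_def)
  have tail: "\<exists>K>0. \<forall>n\<ge>1. integrable (M n) (\<lambda>x. (D n 1 x)\<^sup>2)
      \<and> integrable (M n) (\<lambda>x. ?T K (D n 1 x))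
      \<and> (\<integral>x. ?T K (D n 1 x) \<partial>M n) \<le> e \<and> (\<integral>x. (D n 1 x)\<^sup>2 \<partial>M n) \<le> K + e"
    if e: "0 < e" for e
  proof -
    obtain K where K: "0 < K" and le: "\<And>n. n \<in> {1..} \<Longrightarrow>
        (\<integral>\<^sup>+ x. ennreal \<bar>(D n 1 x)\<^sup>2\<bar> * indicator {x. K < \<bar>(D n 1 x)\<^sup>2\<bar>} x \<partial>M n) \<le> ennreal e"
      by (rule uniformly_integrable_tail[OF assms(6) e]) blast
    show ?thesis
    proof (intro exI[of _ K] conjI[OF K] allI impI)
      fix n :: nat assume n: "1 \<le> n"
      interpret prob_space "M n" using prob n .
      have D2: "(\<lambda>x. (D n 1 x)\<^sup>2) \<in> borel_measurable (M n)" using Dm[OF n, of 1] by measurable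
      show "integrable (M n) (\<lambda>x. (D n 1 x)\<^sup>2) \<and> integrable (M n) (\<lambda>x. ?T K (D n 1 x))
          \<and> (\<integral>x. ?T K (D n 1 x) \<partial>M n) \<le> e \<and> (\<integral>x. (D n 1 x)\<^sup>2 \<partial>M n) \<le> K + e"
        using integrable_of_tail[OF D2 _ K _ le] e n by simp
    qed
  qed
  obtain B where sq: "\<And>n. 1 \<le> n \<Longrightarrow> integrable (M n) (\<lambda>x. (D n 1 x)\<^sup>2)"
    and B: "\<And>n. 1 \<le> n \<Longrightarrow> (\<integral>x. (D n 1 x)\<^sup>2 \<partial>M n) \<le> B"
    using tail[of 1] by auto
  have "\<Lambda> \<longlonglongrightarrow> 0"
  proof (rule LIMSEQ_I)
    fix e :: real assume e: "0 < e"
    then obtain K where K: "0 < K"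
      "\<And>n. 1 \<le> n \<Longrightarrow> integrable (M n) (\<lambda>x. ?T K (D n 1 x))"
      "\<And>n. 1 \<le> n \<Longrightarrow> (\<integral>x. ?T K (D n 1 x) \<partial>M n) \<le> e / 2"
      using tail[of "e / 2"] by auto
    have "(\<lambda>n. K * sqrt K / sqrt (real n)) \<longlonglongrightarrow> 0"
      by (intro tendsto_divide_0[OF tendsto_const] filterlim_at_top_imp_at_infinity
          filterlim_compose[OF sqrt_at_top filterlim_real_sequentially])
    then have "\<forall>\<^sub>F n in sequentially. K * sqrt K / sqrt (real n) < e / 2"
      using e by (intro order_tendstoD) auto
    then have "\<forall>\<^sub>F n in sequentially. norm (\<Lambda> n - 0) < e"
      using eventually_ge_at_top[of 1]
    proof eventually_elim
      case (elim n)
      interpret prob_space "M n" using prob elim(2) .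
      have [measurable]: "D n 1 \<in> borel_measurable (M n)" using Dm elim(2) .
      have i: "integrable (M n) (\<lambda>x. (D n 1 x)\<^sup>2 * min 1 (\<bar>D n 1 x\<bar> / sqrt (real n)))"
        by (rule Bochner_Integration.integrable_bound[OF sq[OF elim(2)]])
          (auto simp: abs_mult mult_left_le)
      have "\<Lambda> n \<le> (\<integral>x. ?T K (D n 1 x) + K * sqrt K / sqrt (real n) \<partial>M n)"
        unfolding \<Lambda>_def
        using i K(2)[OF elim(2)] elim(2) square_min_le_tail[OF K(1)]
        by (intro integral_mono Bochner_Integration.integrable_add) auto
      also have "\<dots> = (\<integral>x. ?T K (D n 1 x) \<partial>M n) + K * sqrt K / sqrt (real n)"
        using K(2)[OF elim(2)] by (subst Bochner_Integration.integral_add) (auto simp: prob_space)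
      finally have "\<Lambda> n < e" using K(3)[OF elim(2)] elim(1) by linarith
      moreover have "0 \<le> \<Lambda> n" unfolding \<Lambda>_def by simp
      ultimately show ?case by simp
    qed
    then show "\<exists>no. \<forall>n\<ge>no. norm (\<Lambda> n - 0) < e" by (simp add: eventually_sequentially)
  qed
  have Lsq: "integrable N (\<lambda>y. (L j y)\<^sup>2)" if j: "1 \<le> j" for j
  proof -
    have avg: "integrable N (\<lambda>y. (1 / real j) * (\<Sum>i=1..j. (L i y)\<^sup>2))"
      using assms(10) j by (simp add: L1_tendsto_const_def)
    have "integrable N (\<lambda>y. real j * ((1 / real j) * (\<Sum>i=1..j. (L i y)\<^sup>2)))"
      by (rule integrable_mult_right[OF avg])
    then have "integrable N (\<lambda>y. \<Sum>i=1..j. (L i y)\<^sup>2)" using j by simp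
    then show ?thesis
    proof (rule Bochner_Integration.integrable_bound)
      show "(\<lambda>y. (L j y)\<^sup>2) \<in> borel_measurable N" using assms(8)[OF j] by measurable
      show "AE y in N. norm ((L j y)\<^sup>2) \<le> norm (\<Sum>i=1..j. (L i y)\<^sup>2)"
        using j by (auto intro!: AE_I2 member_le_sum simp: sum_nonneg)
    qed
  qed
  have "\<Delta> \<longlonglongrightarrow> 0"
  proof (rule LIMSEQ_I)
    fix e :: real assume e: "0 < e"
    have "(\<lambda>m. \<integral>y. \<bar>(1 / real m) * (\<Sum>j=1..m. (L j y)\<^sup>2) - c\<^sup>2\<bar> \<partial>N) \<longlonglongrightarrow> 0"
      using assms(10) by (simp add: L1_tendsto_const_def)
    then have "\<forall>\<^sub>F m in sequentially.
        (\<integral>y. \<bar>(1 / real m) * (\<Sum>j=1..m. (L j y)\<^sup>2) - c\<^sup>2\<bar> \<partial>N) < e / 3"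
      using e by (intro order_tendstoD) auto
    then obtain m where m: "1 \<le> m"
      and Lm: "(\<integral>y. \<bar>(1 / real m) * (\<Sum>j=1..m. (L j y)\<^sup>2) - c\<^sup>2\<bar> \<partial>N) < e / 3"
      using eventually_happens'[OF sequentially_bot eventually_conj[OF _ eventually_ge_at_top[of 1]]]
      by blast
    have "\<forall>\<^sub>F n in sequentially.
        (\<integral>x. \<bar>(1 / real m) * (\<Sum>j=1..m. (D n (int j) x)\<^sup>2) - c\<^sup>2\<bar> \<partial>M n)
        \<le> (\<integral>y. \<bar>(1 / real m) * (\<Sum>j=1..m. (L j y)\<^sup>2) - c\<^sup>2\<bar> \<partial>N) + e / 3"
    proof (rule second_moment_block_limit[OF prob assms(7) m assms(9)[OF m]])
      show "integrable (M n) (\<lambda>x. (D n (int j) x)\<^sup>2)" if "1 \<le> n" for n j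
        using strictly_stationary_marginal(1)[OF stat[OF that], of "\<lambda>y. y\<^sup>2" "int j"] sq[OF that] by simp
      show "\<exists>K>0. \<forall>n\<ge>1. \<forall>j\<in>{1..m}. (\<integral>x. ?T K (D n (int j) x) \<partial>M n) \<le> d" if d: "0 < d" for d
      proof -
        obtain K where K: "0 < K" "\<And>n. 1 \<le> n \<Longrightarrow> (\<integral>x. ?T K (D n 1 x) \<partial>M n) \<le> d"
          using tail[OF d] by auto
        have eq: "(\<integral>x. ?T K (D n k x) \<partial>M n) = (\<integral>x. ?T K (D n 1 x) \<partial>M n)" if "1 \<le> n" for n k
          by (rule strictly_stationary_marginal(2)[OF stat[OF that], of "?T K"]) measurable
        show ?thesis
          by (intro exI[of _ K] conjI K(1) allI impI ballI) (rule ord_eq_le_trans[OF eq K(2)])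
      qed
    qed (use Dm assms(8) Lsq e in auto)
    moreover have "\<forall>\<^sub>F n in sequentially. real m * (B + c\<^sup>2) / real n < e / 3"
    proof -
      have "(\<lambda>n. real m * (B + c\<^sup>2) / real n) \<longlonglongrightarrow> 0"
        by (rule lim_const_over_n)
      then show ?thesis using e by (intro order_tendstoD) auto
    qed
    ultimately have "\<forall>\<^sub>F n in sequentially. norm (\<Delta> n - 0) < e"
      using eventually_ge_at_top[of 1]
    proof eventually_elim
      case (elim n)
      interpret prob_space "M n" using prob elim(3) .
      have st2: "strictly_stationary (M n) (\<lambda>k x. (D n k x)\<^sup>2)"
        by (rule strictly_stationary_compose[OF stat[OF elim(3)]]) measurable
      have "\<Delta> n \<le> (\<integral>x. \<bar>(1 / real m) * (\<Sum>j=1..m. (D n (int j) x)\<^sup>2) - c\<^sup>2\<bar> \<partial>M n)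
          + real m * ((\<integral>x. \<bar>(D n 1 x)\<^sup>2\<bar> \<partial>M n) + \<bar>c\<^sup>2\<bar>) / real n"
        unfolding \<Delta>_def by (rule stationary_average_le_block_average[OF st2 sq[OF elim(3)] m elim(3)])
      also have "real m * ((\<integral>x. \<bar>(D n 1 x)\<^sup>2\<bar> \<partial>M n) + \<bar>c\<^sup>2\<bar>) / real n \<le> real m * (B + c\<^sup>2) / real n"
        using B[OF elim(3)] by (intro divide_right_mono mult_left_mono) auto
      finally have "\<Delta> n < e" using elim(1,2) Lm by linarith
      moreover have "0 \<le> \<Delta> n" unfolding \<Delta>_def by simp
      ultimately show ?case by simp
    qed
    then show "\<exists>no. \<forall>n\<ge>no. norm (\<Delta> n - 0) < e" by (simp add: eventually_sequentially)
  qed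
  have char_\<nu>: "char ?\<nu> t = exp (- (t\<^sup>2 * c\<^sup>2) / 2)" for t
  proof -
    have "char ?\<nu> t = char std_normal_distribution (t * c)"
      by (simp add: char_def integral_distr mult_ac)
    then show ?thesis by (simp add: char_std_normal_distribution power_mult_distrib)
  qed
  have char_lim: "(\<lambda>n. char (?\<mu> n) t) \<longlonglongrightarrow> char ?\<nu> t" for t
  proof -
    obtain C where C: "\<And>y. cmod (balanced_exp t y - 1 - \<i> * complex_of_real (t * y)) \<le> C * cubic_weight y"
      using balanced_exp_expansion[of t] by blast
    let ?A = "t\<^sup>2 / 2 * exp (t\<^sup>2 / 2) + 1 + exp (t\<^sup>2) + C * exp (t\<^sup>2)"
    have lim: "(\<lambda>n. ?A * (\<Delta> n + \<Lambda> n)) \<longlonglongrightarrow> 0"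
      using tendsto_mult_right_zero[OF tendsto_add_zero[OF \<open>\<Delta> \<longlonglongrightarrow> 0\<close> \<open>\<Lambda> \<longlonglongrightarrow> 0\<close>]] .
    have "cmod (char (?\<mu> n) t - char ?\<nu> t) \<le> ?A * (\<Delta> n + \<Lambda> n)" if n: "1 \<le> n" for n
      unfolding char_\<nu> \<Delta>_def \<Lambda>_def
      by (rule prob_space.stationary_martingale_char_bound[OF prob[OF n] filt[OF n] mds[OF n] stat[OF n] sq[OF n] n C])
    then have "\<forall>\<^sub>F n in sequentially. norm (char (?\<mu> n) t - char ?\<nu> t) \<le> ?A * (\<Delta> n + \<Lambda> n)"
      by (rule eventually_mono[OF eventually_ge_at_top[of 1]])
    then have "(\<lambda>n. char (?\<mu> n) t - char ?\<nu> t) \<longlonglongrightarrow> 0"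
      using lim by (rule Lim_null_comparison)
    then show ?thesis by (rule LIM_zero_cancel)
  qed
  \<comment> \<open>The row \<open>0\<close> need not be a probability space, so the continuity theorem is applied to the
    shifted sequence.\<close>
  have "weak_conv_m (\<lambda>n. ?\<mu> (Suc n)) ?\<nu>"
  proof (rule levy_continuity)
    show "real_distribution (?\<mu> (Suc n))" for n
    proof -
      interpret prob_space "M (Suc n)" by (rule prob) simp
      show ?thesis using Dm[of "Suc n"] by (intro real_distribution_distr) auto
    qed
    show "real_distribution ?\<nu>"
    proof -
      interpret real_distribution std_normal_distribution by (rule real_dist_normal_dist)
      show ?thesis by (intro real_distribution_distr) auto
    qed
    show "(\<lambda>n. char (?\<mu> (Suc n)) t) \<longlonglongrightarrow> char ?\<nu> t" for t
      using char_lim by (rule LIMSEQ_Suc)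
  qed
  then have "(\<lambda>n. cdf (?\<mu> n) x) \<longlonglongrightarrow> cdf ?\<nu> x" if "isCont (cdf ?\<nu>) x" for x
    using that unfolding weak_conv_m_def weak_conv_def
    by (intro LIMSEQ_imp_Suc[where f="\<lambda>n. cdf (?\<mu> n) x"]) blast
  then show ?thesis
    unfolding weak_conv_m_def weak_conv_def by blast
qed

end
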